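(* Let $1\le p<\infty$ and let $B_w$ be a weighted shift on $\ell^p(\mathbb{Z})$ or on $\ell^p(\mathbb{Z}_+)$. Then $B_w$ is reiteratively hypercyclic if and only if $B_w$ is frequently hypercyclic.
   Context: $\mathbb{Z}_+$ is the set of non-negative integers and $(e_n)$ denotes the canonical basis. On $\ell^p(\mathbb{Z}_+)$, for a bounded sequence $w=(w_n)_{n\ge1}$ of non-zero scalars, the weighted (backward) shift $B_w$ is the operator with $B_we_0=0$ and $B_we_n=w_ne_{n-1}$ for $n\ge1$. On $\ell^p(\mathbb{Z})$, for a bounded sequence $w=(w_n)_{n\in\mathbb{Z}}$ of non-zero scalars, $B_w$ is the operator with $B_we_n=w_ne_{n-1}$ for all $n\in\mathbb{Z}$. For $A\subseteq\mathbb{Z}_+$: the lower density is $\underline{d}(A)=\liminf_{k\to\infty}|A\cap[0,k]|/k$; the upper Banach density is $\overline{Bd}(A)=\lim_{s\to\infty}\alpha^s/s$, where $\alpha^s=\limsup_{k\to\infty}|A\cap[k+1,k+s]|$ (the limit always exists). For a continuous linear operator $T$ on $X$, $x\in X$ and $V\subset X$, $N(x,V)=\{n\ge0:T^nx\in V\}$. $T$ is frequently hypercyclic if there exists $x\in X$ such that $\underline{d}(N(x,V))>0$ for every non-empty open $V\subset X$; $T$ is reiteratively hypercyclic if there exists $x\in X$ such that $\overline{Bd}(N(x,V))>0$ for every non-empty open $V\subset X$. *)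

theory Defs
  imports "HOL-Analysis.Analysis"
begin

section \<open>The spaces $\ell^p$\<close>

text \<open>
  Sequences are functions on the index type; the index types of interest are
  \<^typ>\<open>nat\<close> (for $\mathbb{Z}_+$) and \<^typ>\<open>int\<close> (for $\mathbb{Z}$).  The type class of
  the scalars, real normed fields that are Euclidean spaces, has (up to isometric isomorphism)
  exactly the two members \<^typ>\<open>real\<close> and \<^typ>\<open>complex\<close>.
\<close>

definition lp_space :: "real \<Rightarrow> ('i \<Rightarrow> 'k::{real_normed_field,euclidean_space}) set" where
  "lp_space p = {x. (\<lambda>i. norm (x i) powr p) summable_on UNIV}"

definition lp_norm :: "real \<Rightarrow> ('i \<Rightarrow> 'k::{real_normed_field,euclidean_space}) \<Rightarrow> real" where
  "lp_norm p x = (\<Sum>\<^sub>\<infinity>i. norm (x i) powr p) powr (1 / p)"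

definition lp_dist ::
  "real \<Rightarrow> ('i \<Rightarrow> 'k::{real_normed_field,euclidean_space}) \<Rightarrow> ('i \<Rightarrow> 'k) \<Rightarrow> real" where
  "lp_dist p x y = lp_norm p (\<lambda>i. x i - y i)"

definition lp_topology ::
  "real \<Rightarrow> ('i \<Rightarrow> 'k::{real_normed_field,euclidean_space}) topology" where
  "lp_topology p = Metric_space.mtopology (lp_space p) (lp_dist p)"

text \<open>
  The topology of \<^locale>\<open>Metric_space\<close> is meaningful only once the metric axioms hold, which
  requires Minkowski's inequality.
\<close>

lemma powr_convex_combination:
  fixes a b u v p :: real
  assumes "p \<ge> 1" "a \<ge> 0" "b \<ge> 0" "u \<ge> 0" "v \<ge> 0" "u + v = 1"
  shows "(u * a + v * b) powr p \<le> u * a powr p + v * b powr p"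
proof -
  have le1: "t powr p \<le> t" if "0 \<le> t" "t \<le> 1" for t :: real
    using that assms(1) powr_mono'[of 1 p t] by auto
  show ?thesis
  proof (cases "a = 0 \<or> b = 0")
    case True
    have "(v * b) powr p \<le> v * b powr p" "(u * a) powr p \<le> u * a powr p"
      using assms le1[of v] le1[of u] by (auto simp: powr_mult intro!: mult_right_mono)
    with True show ?thesis using assms by auto
  next
    case False
    have u: "u = 1 - v" using assms by simp
    show ?thesis
      unfolding u using convex_onD[OF powr_convex[OF assms(1)], of v a b] False assms by simp
  qed
qed

lemma lp_norm_nonneg: "0 \<le> lp_norm p x"
  by (simp add: lp_norm_def)

lemma lp_norm_powr:
  assumes "p \<ge> 1"
  shows "lp_norm p x powr p = (\<Sum>\<^sub>\<infinity>i. norm (x i) powr p)"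
  using assms by (simp add: lp_norm_def powr_powr infsum_nonneg)

lemma lp_norm_eq_0_iff:
  assumes "p \<ge> 1" "x \<in> lp_space p"
  shows "lp_norm p x = 0 \<longleftrightarrow> x = (\<lambda>_. 0)"
proof
  assume "lp_norm p x = 0"
  then have "(\<Sum>\<^sub>\<infinity>i. norm (x i) powr p) \<le> 0"
    by (simp add: lp_norm_def)
  then have "norm (x i) powr p = 0" for i
    using assms(2) by (intro nonneg_infsum_le_0D[where A = UNIV and f = "\<lambda>i. norm (x i) powr p"])
      (auto simp: lp_space_def)
  then show "x = (\<lambda>_. 0)" by auto
qed (simp add: lp_norm_def)

lemma lp_Minkowski:
  fixes x y :: "'i \<Rightarrow> 'k::{real_normed_field,euclidean_space}"
  assumes p: "p \<ge> 1" and x: "x \<in> lp_space p" and y: "y \<in> lp_space p"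
  shows lp_space_add: "(\<lambda>i. x i + y i) \<in> lp_space p"
    and lp_norm_add: "lp_norm p (\<lambda>i. x i + y i) \<le> lp_norm p x + lp_norm p y"
proof -
  define a b where "a = lp_norm p x" and "b = lp_norm p y"
  have "(\<lambda>i. x i + y i) \<in> lp_space p \<and> lp_norm p (\<lambda>i. x i + y i) \<le> a + b"
  proof (cases "a = 0 \<or> b = 0")
    case True
    then have "x = (\<lambda>_. 0) \<or> y = (\<lambda>_. 0)"
      unfolding a_def b_def lp_norm_eq_0_iff[OF p x] lp_norm_eq_0_iff[OF p y] .
    then show ?thesis
      using x y lp_norm_nonneg[of p x] lp_norm_nonneg[of p y] by (auto simp: a_def b_def)
  next
    case False
    then have a: "a > 0" and b: "b > 0"
      using lp_norm_nonneg[of p x] lp_norm_nonneg[of p y] unfolding a_def b_def by linarith+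
    define u v where "u = a / (a + b)" and "v = b / (a + b)"
    have uv: "u \<ge> 0" "v \<ge> 0" "u + v = 1"
      using a b by (auto simp: u_def v_def add_divide_distrib[symmetric])
    define h where "h = (\<lambda>i. (a + b) powr p *
      (u * (norm (x i) powr p / a powr p) + v * (norm (y i) powr p / b powr p)))"
    have le: "norm (x i + y i) powr p \<le> h i" for i
    proof -
      have "norm (x i + y i) \<le> (a + b) * (u * (norm (x i) / a) + v * (norm (y i) / b))"
      proof -
        have "(a + b) * (u * (norm (x i) / a) + v * (norm (y i) / b)) = norm (x i) + norm (y i)"
          using a b by (simp add: u_def v_def distrib_left)
        then show ?thesis using norm_triangle_ineq[of "x i" "y i"] by simp
      qed
      then have "norm (x i + y i) powr p
          \<le> ((a + b) * (u * (norm (x i) / a) + v * (norm (y i) / b))) powr p"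
        using p by (intro powr_mono2) auto
      also have "\<dots> = (a + b) powr p * (u * (norm (x i) / a) + v * (norm (y i) / b)) powr p"
        using a b uv by (intro powr_mult) 
      also have "\<dots> \<le> (a + b) powr p *
          (u * (norm (x i) / a) powr p + v * (norm (y i) / b) powr p)"
        using a b uv p by (intro mult_left_mono powr_convex_combination) auto
      also have "\<dots> = h i"
        using a b by (simp add: h_def powr_divide)
      finally show ?thesis .
    qed
    have hx: "((\<lambda>i. norm (x i) powr p) has_sum a powr p) UNIV"
      and hy: "((\<lambda>i. norm (y i) powr p) has_sum b powr p) UNIV"
      using x y unfolding a_def b_def lp_norm_powr[OF p] lp_space_def by auto
    have "(h has_sum ((a + b) powr p *
        (u * (a powr p / a powr p) + v * (b powr p / b powr p)))) UNIV"
      unfolding h_def divide_inverse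
      by (intro has_sum_cmult_right has_sum_add has_sum_cmult_left hx hy)
    then have h: "(h has_sum ((a + b) powr p)) UNIV"
      using a b uv by simp
    have sm: "(\<lambda>i. norm (x i + y i) powr p) summable_on UNIV"
      by (rule summable_on_comparison_test[OF has_sum_imp_summable[OF h]]) (use le in auto)
    have "(\<Sum>\<^sub>\<infinity>i. norm (x i + y i) powr p) \<le> (a + b) powr p"
      using has_sum_mono[OF has_sum_infsum[OF sm] h] le by auto
    then have "lp_norm p (\<lambda>i. x i + y i) \<le> ((a + b) powr p) powr (1 / p)"
      unfolding lp_norm_def using p by (intro powr_mono2 infsum_nonneg) auto
    also have "\<dots> = a + b"
      using a b p by (simp add: powr_powr)
    finally show ?thesis using sm by (simp add: lp_space_def)
  qed
  then show "(\<lambda>i. x i + y i) \<in> lp_space p"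
    and "lp_norm p (\<lambda>i. x i + y i) \<le> lp_norm p x + lp_norm p y"
    by (auto simp: a_def b_def)
qed

lemma lp_space_scale:
  assumes "x \<in> lp_space p"
  shows "(\<lambda>i. c * x i) \<in> lp_space p"
  using assms by (auto simp: lp_space_def norm_mult powr_mult intro: summable_on_cmult_right)

lemma lp_space_diff:
  assumes "p \<ge> 1" "x \<in> lp_space p" "y \<in> lp_space p"
  shows "(\<lambda>i. x i - y i) \<in> lp_space p"
  using lp_space_add[OF assms(1,2) lp_space_scale[OF assms(3), of "-1"]] by simp

lemma Metric_space_lp:
  fixes p :: real
  assumes p: "p \<ge> 1"
  shows "Metric_space (lp_space p :: ('i \<Rightarrow> 'k::{real_normed_field,euclidean_space}) set) (lp_dist p)"
proof
  fix x y z :: "'i \<Rightarrow> 'k"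
  show "0 \<le> lp_dist p x y"
    by (simp add: lp_dist_def lp_norm_nonneg)
  show "lp_dist p x y = lp_dist p y x"
    by (simp add: lp_dist_def lp_norm_def norm_minus_commute)
  assume x: "x \<in> lp_space p" and y: "y \<in> lp_space p"
  show "lp_dist p x y = 0 \<longleftrightarrow> x = y"
    unfolding lp_dist_def using lp_norm_eq_0_iff[OF p lp_space_diff[OF p x y]]
    by (auto simp: fun_eq_iff)
  assume z: "z \<in> lp_space p"
  show "lp_dist p x z \<le> lp_dist p x y + lp_dist p y z"
    unfolding lp_dist_def
    using lp_norm_add[OF p lp_space_diff[OF p x y] lp_space_diff[OF p y z]] by simp
qed


section \<open>Weighted shifts\<close>

text \<open>
  The formula is the continuous linear extension of $e_n \mapsto w_n e_{n-1}$
  (together with $e_0 \mapsto 0$ if the index type is \<^typ>\<open>nat\<close>), see the lemmas below.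
\<close>

definition weighted_shift :: "('i::{plus,one} \<Rightarrow> 'k::{real_normed_field,euclidean_space})
    \<Rightarrow> ('i \<Rightarrow> 'k) \<Rightarrow> ('i \<Rightarrow> 'k)" where
  "weighted_shift w x = (\<lambda>n. w (n + 1) * x (n + 1))"

definition unit_seq :: "'i \<Rightarrow> 'i \<Rightarrow> 'k::{real_normed_field,euclidean_space}" where
  "unit_seq n = (\<lambda>i. if i = n then 1 else 0)"

lemma weighted_shift_nat_unit_seq:
  fixes n :: nat
  shows "weighted_shift w (unit_seq 0 :: nat \<Rightarrow> 'k::{real_normed_field,euclidean_space}) = (\<lambda>_. 0)"
    and "n \<ge> 1 \<Longrightarrow> weighted_shift w (unit_seq n) = (\<lambda>i. w n * unit_seq (n - 1) i)"
  by (auto simp: weighted_shift_def unit_seq_def fun_eq_iff)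

lemma weighted_shift_int_unit_seq:
  fixes n :: int
  shows "weighted_shift w (unit_seq n) = (\<lambda>i. w n * unit_seq (n - 1) i)"
  by (auto simp: weighted_shift_def unit_seq_def fun_eq_iff)

lemma weighted_shift_linear:
  "weighted_shift w (\<lambda>i. a * x i + b * y i) =
    (\<lambda>i. a * weighted_shift w x i + b * weighted_shift w y i)"
  by (simp add: weighted_shift_def algebra_simps)

text \<open>The value \<open>w 0\<close> plays no role for the index type \<^typ>\<open>nat\<close>.\<close>

lemma weighted_shift_bounded:
  fixes w :: "'i::{plus,one} \<Rightarrow> 'k::{real_normed_field,euclidean_space}"
  assumes p: "p \<ge> 1" and inj: "inj (\<lambda>n::'i. n + 1)" and x: "x \<in> lp_space p"
    and M: "\<And>n. norm (w (n + 1)) \<le> M"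
  shows "weighted_shift w x \<in> lp_space p"
    and "lp_norm p (weighted_shift w x) \<le> M * lp_norm p x"
proof -
  have M0: "M \<ge> 0" using M norm_ge_zero order_trans by blast
  define f where "f = (\<lambda>i. norm (x i) powr p)"
  have f: "f summable_on UNIV" using x by (simp add: f_def lp_space_def)
  then have fr: "f summable_on range (\<lambda>n. n + 1)"
    by (rule summable_on_subset_banach) auto
  have g: "(\<lambda>n. f (n + 1)) summable_on UNIV"
    using fr summable_on_reindex[OF inj, of f] by (simp add: o_def)
  have "(\<Sum>\<^sub>\<infinity>n. f (n + 1)) = infsum f (range (\<lambda>n. n + 1))"
    using infsum_reindex[OF inj, of f] by (simp add: o_def)
  also have "\<dots> \<le> infsum f UNIV"
    using f fr by (intro infsum_mono_neutral) (auto simp: f_def)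
  finally have gf: "(\<Sum>\<^sub>\<infinity>n. f (n + 1)) \<le> infsum f UNIV" .
  have le: "norm (weighted_shift w x n) powr p \<le> M powr p * f (n + 1)" for n
    using M p by (auto simp: weighted_shift_def norm_mult f_def powr_mult
        intro!: mult_right_mono powr_mono2)
  have gM: "(\<lambda>n. M powr p * f (n + 1)) summable_on UNIV"
    using g by (rule summable_on_cmult_right)
  have sm: "(\<lambda>n. norm (weighted_shift w x n) powr p) summable_on UNIV"
    by (rule summable_on_comparison_test[OF gM]) (use le in auto)
  then show "weighted_shift w x \<in> lp_space p" by (simp add: lp_space_def)
  have "(\<Sum>\<^sub>\<infinity>n. norm (weighted_shift w x n) powr p) \<le> (\<Sum>\<^sub>\<infinity>n. M powr p * f (n + 1))"
    using sm gM le by (intro infsum_mono) auto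
  also have "\<dots> = M powr p * (\<Sum>\<^sub>\<infinity>n. f (n + 1))"
    by (rule infsum_cmult_right) (use g in auto)
  also have "\<dots> \<le> M powr p * infsum f UNIV"
    using gf by (intro mult_left_mono) auto
  also have "\<dots> = (M * lp_norm p x) powr p"
    using lp_norm_powr[OF p, of x] M0 lp_norm_nonneg[of p x] by (simp add: powr_mult f_def)
  finally have "lp_norm p (weighted_shift w x) \<le> ((M * lp_norm p x) powr p) powr (1 / p)"
    unfolding lp_norm_def[of p "weighted_shift w x"] using p
    by (intro powr_mono2 infsum_nonneg) auto
  also have "\<dots> = M * lp_norm p x"
    using p M0 lp_norm_nonneg[of p x] by (simp add: powr_powr)
  finally show "lp_norm p (weighted_shift w x) \<le> M * lp_norm p x" .
qed


section \<open>Densities\<close>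

definition lower_density :: "nat set \<Rightarrow> ereal" where
  "lower_density A = liminf (\<lambda>k. ereal (real (card (A \<inter> {0..k})) / real k))"

definition banach_count :: "nat set \<Rightarrow> nat \<Rightarrow> ereal" where
  "banach_count A s = limsup (\<lambda>k. ereal (real (card (A \<inter> {k + 1..k + s}))))"

definition upper_banach_density :: "nat set \<Rightarrow> ereal" where
  "upper_banach_density A = lim (\<lambda>s. banach_count A s / ereal (real s))"

text \<open>
  The limit always exists, by subadditivity.
\<close>

lemma banach_count_le: "banach_count A s \<le> ereal (real s)"
  unfolding banach_count_def
proof (rule Limsup_bounded, intro always_eventually allI)
  fix k
  have "card (A \<inter> {k + 1..k + s}) \<le> card {k + 1..k + s}"
    by (rule card_mono) auto
  then show "ereal (real (card (A \<inter> {k + 1..k + s}))) \<le> ereal (real s)"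
    by simp
qed

lemma banach_count_nonneg: "0 \<le> banach_count A s"
  unfolding banach_count_def by (rule le_Limsup) auto

lemma banach_count_add: "banach_count A (s + t) \<le> banach_count A s + banach_count A t"
proof -
  let ?c = "\<lambda>t k. ereal (real (card (A \<inter> {k + 1..k + t})))"
  have split: "A \<inter> {k + 1..k + (s + t)} = (A \<inter> {k + 1..k + s}) \<union> (A \<inter> {k + s + 1..k + s + t})"
    for k by auto
  have "?c (s + t) k \<le> ?c s k + ?c t (k + s)" for k
    unfolding split using card_Un_le[of "A \<inter> {k + 1..k + s}" "A \<inter> {k + s + 1..k + s + t}"] by simp
  then have "limsup (?c (s + t)) \<le> limsup (\<lambda>k. ?c s k + ?c t (k + s))"
    by (intro Limsup_mono always_eventually allI)
  also have "\<dots> \<le> limsup (?c s) + limsup (\<lambda>k. ?c t (k + s))"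
    by (rule ereal_limsup_add_mono)
  also have "limsup (\<lambda>k. ?c t (k + s)) = limsup (?c t)"
    by (rule limsup_shift_k)
  finally show ?thesis by (simp add: banach_count_def)
qed

lemma upper_banach_density_limit:
  "(\<lambda>s. banach_count A s / ereal (real s)) \<longlonglongrightarrow> upper_banach_density A"
proof -
  define a where "a s = real_of_ereal (banach_count A s)" for s
  have a: "banach_count A s = ereal (a s)" for s
    using banach_count_le[of A s] banach_count_nonneg[of A s]
    unfolding a_def by (cases "banach_count A s") auto
  have a0: "0 \<le> a s" and as: "a s \<le> real s" and add: "a (s + t) \<le> a s + a t" for s t
    using banach_count_nonneg[of A s] banach_count_le[of A s] banach_count_add[of A s t]
    by (simp_all add: a)
  have mult: "a (q * m + r) \<le> real q * a m + a r" for q m r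
  proof (induction q)
    case (Suc q)
    then show ?case using add[of m "q * m + r"] by (simp add: algebra_simps)
  qed simp
  define L where "L = (INF s\<in>{1..}. a s / real s)"
  have bdd: "bdd_below ((\<lambda>s. a s / real s) ` {1..})"
    using a0 by (intro bdd_belowI2[of _ 0]) auto
  have "(\<lambda>s. a s / real s) \<longlonglongrightarrow> L"
  proof (rule LIMSEQ_I)
    fix e :: real assume e: "e > 0"
    have "(INF s\<in>{1..}. a s / real s) < L + e / 2" using e by (simp add: L_def)
    then have "\<exists>m\<in>{1..}. a m / real m < L + e / 2"
      by (rule iffD1[OF cINF_less_iff[OF _ bdd], rotated]) auto
    then obtain m where m: "m \<ge> 1" "a m / real m < L + e / 2" by auto
    obtain N where N: "real N > 2 * real m / e" using reals_Archimedean2 by blast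
    show "\<exists>no. \<forall>n\<ge>no. norm (a n / real n - L) < e"
    proof (intro exI allI impI)
      fix n assume n: "n \<ge> Suc N"
      have "a n \<le> real (n div m) * a m + a (n mod m)"
        using mult[of "n div m" m "n mod m"] by simp
      also have "\<dots> \<le> real n / real m * a m + real m"
      proof (rule add_mono)
        show "real (n div m) * a m \<le> real n / real m * a m"
          using a0 by (intro mult_right_mono of_nat_div_le_of_nat)
        have "real (n mod m) \<le> real m" using m by simp
        then show "a (n mod m) \<le> real m" using as[of "n mod m"] by linarith
      qed
      finally have "a n / real n \<le> (real n / real m * a m + real m) / real n"
        by (rule divide_right_mono) simp
      also have "\<dots> = a m / real m + real m / real n"
        using n m by (simp add: add_divide_distrib)
      also have "real m / real n < e / 2"
      proof -
        have "2 * real m < real n * e"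
        proof -
          have "2 * real m < real N * e" using N e by (simp add: pos_divide_less_eq)
          also have "\<dots> \<le> real n * e" using n e by (intro mult_right_mono) auto
          finally show ?thesis .
        qed
        then show ?thesis using n by (simp add: pos_divide_less_eq mult.commute)
      qed
      finally have "a n / real n < L + e" using m by simp
      moreover have "L \<le> a n / real n"
        unfolding L_def using n by (intro cINF_lower bdd) auto
      ultimately show "norm (a n / real n - L) < e" by simp
    qed
  qed
  then have "(\<lambda>s. ereal (a s / real s)) \<longlonglongrightarrow> ereal L" by simp
  moreover have "\<forall>\<^sub>F s in sequentially. ereal (a s / real s) = banach_count A s / ereal (real s)"
    using eventually_gt_at_top[of 0] by eventually_elim (simp add: a)
  ultimately have "(\<lambda>s. banach_count A s / ereal (real s)) \<longlonglongrightarrow> ereal L"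
    by (rule Lim_transform_eventually)
  then show ?thesis
    unfolding upper_banach_density_def by (simp add: limI)
qed


section \<open>Frequent and reiterative hypercyclicity\<close>

definition return_times :: "('x \<Rightarrow> 'x) \<Rightarrow> 'x \<Rightarrow> 'x set \<Rightarrow> nat set" where
  "return_times T x V = {n. (T ^^ n) x \<in> V}"

definition frequently_hypercyclic :: "'x topology \<Rightarrow> ('x \<Rightarrow> 'x) \<Rightarrow> bool" where
  "frequently_hypercyclic X T \<longleftrightarrow>
    (\<exists>x\<in>topspace X. \<forall>V. openin X V \<and> V \<noteq> {} \<longrightarrow> lower_density (return_times T x V) > 0)"

definition reiteratively_hypercyclic :: "'x topology \<Rightarrow> ('x \<Rightarrow> 'x) \<Rightarrow> bool" where
  "reiteratively_hypercyclic X T \<longleftrightarrow>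
    (\<exists>x\<in>topspace X. \<forall>V. openin X V \<and> V \<noteq> {} \<longrightarrow> upper_banach_density (return_times T x V) > 0)"

end

theory Submission
  imports Defs
begin

text \<open>
  Given bounded nonzero weights on the integers, let \<open>v\<close> solve \<open>v k = w (k + 1) * v (k + 1)\<close> with
  \<open>v 0 = 1\<close>.  Writing \<open>x k = v k * z k\<close> turns the weighted shift into the plain shift of
  \<open>z\<close>, acting on the sequences that are \<open>p\<close>-summable with respect to the masses
  \<open>\<mu> k = norm (v k) powr p\<close>.  Both notions of hypercyclicity turn out to be equivalent to
  the finiteness of the total mass, that is, to \<open>v \<in> lp_space p\<close>.

  Suppose that the shift is reiteratively hypercyclic, and let \<open>E\<close> be the set of return times of the
  orbit to a small ball around the unit vector at 0.  Then \<open>z m\<close> has norm at least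
  \<open>1 / 2\<close> for all \<open>m \<in> E\<close>.  At a time \<open>n \<in> E\<close> these entries have moved to the points of
  \<open>E - n\<close>, and since the shifted vector is close to the unit vector, the mass of \<open>E - n\<close> is
  bounded, uniformly in \<open>n\<close>.  Since \<open>E\<close> has positive upper Banach density, the differences
  realised by a positive proportion of the points of \<open>E\<close> in a long window have bounded gaps (\<open>overlaps_bounded_below_syndetically\<close>).  Averaging the bound over
  \<open>n\<close> shows that these frequent differences have finite total mass, and boundedness of \<open>w\<close>
  transports this to all integers (\<open>summable_on_int_if_bounded_on_differences\<close>).

  Conversely, suppose that the total mass is finite.  Copies of countably many finitely supported
  patterns are placed along sets of positive lower density
  (\<open>separated_sets_of_positive_lower_density\<close>) that are so far apart that, after a shift to any copy of
  a given pattern, everything else contributes only a small tail of a convergent series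
  (\<open>frequently_hypercyclic_bilateral\<close>).

  The unilateral shift is reduced to this by extending the weights by \<open>1 / 2\<close> to the nonpositive
  integers: the added masses form a geometric series, and the unilateral shift is a factor of the
  extended one.  Finally, frequent hypercyclicity implies reiterative hypercyclicity because positive
  lower density implies positive upper Banach density.
\<close>

section \<open>Frequent differences of dense sets of integers\<close>

definition overlap :: "int set \<Rightarrow> int \<Rightarrow> nat" where
  "overlap A k = card {n \<in> A. n + k \<in> A}"

text \<open>
  The second Bonferroni inequality, with every unordered pair counted twice.
\<close>

lemma sum_card_le_card_UN_plus_overlaps:
  assumes "finite H" "\<And>h. h \<in> H \<Longrightarrow> finite (B h)"
  shows "(\<Sum>h\<in>H. card (B h)) \<le> card (\<Union>h\<in>H. B h) + (\<Sum>h\<in>H. \<Sum>h'\<in>H - {h}. card (B h \<inter> B h'))"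
  using assms
proof (induction H rule: finite_induct)
  case (insert a H)
  let ?U = "\<Union>h\<in>H. B h"
  have fin: "finite ?U" "finite (B a)" using insert by auto
  have "card (B a \<inter> ?U) = card (\<Union>h\<in>H. B a \<inter> B h)" by (simp only: Int_UN_distrib)
  also have "\<dots> \<le> (\<Sum>h\<in>H. card (B a \<inter> B h))" using insert by (intro card_UN_le)
  finally have new: "card (B a \<inter> ?U) \<le> (\<Sum>h\<in>H. card (B a \<inter> B h))" .
  have "card (B a) + card ?U = card (B a \<union> ?U) + card (B a \<inter> ?U)"
    by (rule card_Un_Int[OF fin(2,1)])
  moreover have "(\<Sum>h\<in>H. \<Sum>h'\<in>H - {h}. card (B h \<inter> B h'))
      \<le> (\<Sum>h\<in>H. \<Sum>h'\<in>insert a H - {h}. card (B h \<inter> B h'))"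
    using insert by (intro sum_mono sum_mono2) auto
  moreover have "insert a H - {a} = H" using insert by auto
  ultimately show ?case using insert new by simp
qed simp

lemma card_translates_Int_le_overlap:
  assumes "finite A"
  shows "card ((\<lambda>n. n + h) ` A \<inter> (\<lambda>n. n + h') ` A) \<le> overlap A (h - h')"
  unfolding overlap_def
proof (rule card_inj_on_le[of "\<lambda>x. x - h"])
  show "(\<lambda>x. x - h) ` ((\<lambda>n. n + h) ` A \<inter> (\<lambda>n. n + h') ` A) \<subseteq> {n \<in> A. n + (h - h') \<in> A}"
  proof
    fix y assume "y \<in> (\<lambda>x. x - h) ` ((\<lambda>n. n + h) ` A \<inter> (\<lambda>n. n + h') ` A)"
    then obtain n m where "n \<in> A" "m \<in> A" "n + h = m + h'" "y = n" by auto
    moreover from this have "n + (h - h') = m" by simp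
    ultimately show "y \<in> {n \<in> A. n + (h - h') \<in> A}" by simp
  qed
qed (use assms in \<open>auto simp: inj_on_def\<close>)

lemma finite_int_set_bounded:
  assumes "finite (X :: int set)"
  shows "\<exists>b::nat. \<forall>k\<in>X. \<bar>k\<bar> \<le> int b"
proof (intro exI ballI)
  fix k assume "k \<in> X"
  then show "\<bar>k\<bar> \<le> int (nat (\<Sum>k\<in>X. \<bar>k\<bar>))"
    using member_le_sum[of k X abs] assms by (simp add: sum_nonneg)
qed

lemma overlap_minus: "overlap A (- k) = overlap A k"
  unfolding overlap_def by (rule bij_betw_same_card[of "\<lambda>n. n - k"])
    (rule bij_betwI[where g = "\<lambda>n. n + k"], auto)

text \<open>
  Translates of \<open>A s\<close> with pairwise small overlap fit almost disjointly into a window of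
  length about \<open>s\<close>, so there are at most about \<open>1 / d\<close> of them.  If a family \<open>H\<close> of
  shifts is maximal with this property, the translate by any other \<open>g\<close> has a large overlap with the
  translate by some \<open>h \<in> H\<close>, that is, \<open>g - h\<close> is a frequent difference; so frequent differences have gaps
  bounded in terms of \<open>H\<close>.  The maximality is taken over families that work for infinitely many
  \<open>s\<close> simultaneously, which makes \<open>H\<close>, and hence \<open>K\<close>, independent of \<open>s\<close>.
\<close>

lemma overlaps_bounded_below_syndetically:
  fixes A :: "nat \<Rightarrow> int set" and d :: real
  assumes d: "d > 0"
    and sub: "\<And>s. A s \<subseteq> {a s + 1..a s + int s}"
    and dens: "\<forall>s\<ge>s0. d * real s \<le> real (card (A s))"
  shows "\<exists>\<delta>>0. \<exists>K S. infinite S \<and>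
    (\<forall>k. finite {s \<in> S. \<forall>j\<le>K. real (overlap (A s) (k + int j)) < \<delta> * real s})"
proof -
  have fin: "finite (A s)" for s by (rule finite_subset[OF sub]) simp
  obtain r0 :: nat where r0: "real r0 > 4 / d" using reals_Archimedean2 by blast
  with d have r0d: "real r0 * d \<ge> 4" "r0 > 0"
    by (auto simp: field_simps intro: Nat.gr0I)
  \<comment> \<open>\<open>r0\<close> translates have at least \<open>4 * s\<close> points, and all overlaps together at most \<open>s\<close>\<close>
  define \<delta> where "\<delta> = min d (1 / real (r0 * r0))"
  have \<delta>: "\<delta> > 0" "\<delta> \<le> d" "real r0 * real r0 * \<delta> \<le> 1"
    using d r0d by (auto simp: \<delta>_def min_def field_simps)
  \<comment> \<open>the same \<open>r\<close> shifts make the translates of \<open>A s\<close> almost disjoint, for infinitely many \<open>s\<close>\<close>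
  define P where "P r \<longleftrightarrow> (\<exists>H S. finite H \<and> card H = r \<and> infinite S \<and>
    (\<forall>s\<in>S. \<forall>h\<in>H. \<forall>h'\<in>H. h \<noteq> h' \<longrightarrow> real (overlap (A s) (h - h')) < \<delta> * real s))" for r
  have P0: "P 0" unfolding P_def by (rule exI[of _ "{}"], rule exI[of _ UNIV]) auto
  have "\<not> P r0"
  proof
    assume "P r0"
    then obtain H S where H: "finite H" "card H = r0" "infinite S" and
      H': "\<forall>s\<in>S. \<forall>h\<in>H. \<forall>h'\<in>H. h \<noteq> h' \<longrightarrow> real (overlap (A s) (h - h')) < \<delta> * real s"
      unfolding P_def by (elim exE conjE) (rule that)
    note small = H'[rule_format]
    obtain b where b: "\<And>h. h \<in> H \<Longrightarrow> \<bar>h\<bar> \<le> int b"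
      using finite_int_set_bounded[OF H(1)] by blast
    obtain s where s: "s \<in> S" "s \<ge> s0 + b + 1" using H(3) unfolding infinite_nat_iff_unbounded_le by blast
    define B where "B h = (\<lambda>n. n + h) ` A s" for h
    have cB: "card (B h) = card (A s)" for h
      unfolding B_def by (rule card_image) (auto simp: inj_on_def)
    have U: "(\<Union>h\<in>H. B h) \<subseteq> {a s + 1 - int b..a s + int s + int b}"
    proof
      fix x assume "x \<in> (\<Union>h\<in>H. B h)"
      then obtain h n where "h \<in> H" "n \<in> A s" "x = n + h" unfolding B_def by auto
      with b[of h] sub[of s] show "x \<in> {a s + 1 - int b..a s + int s + int b}"
        by (auto simp: abs_le_iff)
    qed
    have "card (\<Union>h\<in>H. B h) \<le> card {a s + 1 - int b..a s + int s + int b}"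
      by (rule card_mono[OF _ U]) simp
    then have cU: "real (card (\<Union>h\<in>H. B h)) \<le> real s + 2 * real b" by simp
    have "real r0 * (d * real s) \<le> real r0 * real (card (A s))"
      using dens s by (intro mult_left_mono) auto
    also have "\<dots> = real (\<Sum>h\<in>H. card (B h))" by (simp add: cB H)
    also have "\<dots> \<le> real (card (\<Union>h\<in>H. B h) + (\<Sum>h\<in>H. \<Sum>h'\<in>H - {h}. card (B h \<inter> B h')))"
      unfolding of_nat_le_iff
      by (rule sum_card_le_card_UN_plus_overlaps) (use H fin in \<open>auto simp: B_def\<close>)
    also have "\<dots> \<le> real s + 2 * real b + (\<Sum>h\<in>H. \<Sum>h'\<in>H - {h}. \<delta> * real s)"
    proof -
      have "real (card (B h \<inter> B h')) \<le> \<delta> * real s" if "h \<in> H" "h' \<in> H - {h}" for h h'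
        using card_translates_Int_le_overlap[OF fin, of h s h'] small[OF s(1), of h h'] that
        by (simp add: B_def)
      then have "(\<Sum>h\<in>H. \<Sum>h'\<in>H - {h}. real (card (B h \<inter> B h')))
          \<le> (\<Sum>h\<in>H. \<Sum>h'\<in>H - {h}. \<delta> * real s)"
        by (intro sum_mono)
      then show ?thesis using cU by (simp only: of_nat_add of_nat_sum)
    qed
    also have "(\<Sum>h\<in>H. \<Sum>h'\<in>H - {h}. \<delta> * real s) \<le> (\<Sum>h\<in>H. \<Sum>h'\<in>H. \<delta> * real s)"
      using H \<delta> by (intro sum_mono sum_mono2) auto
    also have "\<dots> = real r0 * real r0 * \<delta> * real s" using H by simp
    also have "\<dots> \<le> 1 * real s" using \<delta> by (intro mult_right_mono) auto
    finally have "real r0 * d * real s \<le> 2 * real s + 2 * real b" by simp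
    moreover have "4 * real s \<le> real r0 * d * real s" using r0d by (intro mult_right_mono) auto
    ultimately show False using s by simp
  qed
  have "\<exists>r. P r \<and> \<not> P (Suc r)"
  proof (rule ccontr)
    assume step: "\<nexists>r. P r \<and> \<not> P (Suc r)"
    have "P r" for r by (induction r) (use P0 step in auto)
    with \<open>\<not> P r0\<close> show False by simp
  qed
  then obtain r where r: "P r" "\<not> P (Suc r)" by blast
  then obtain H S where H: "finite H" "card H = r" "infinite S" and
    H': "\<forall>s\<in>S. \<forall>h\<in>H. \<forall>h'\<in>H. h \<noteq> h' \<longrightarrow> real (overlap (A s) (h - h')) < \<delta> * real s"
    unfolding P_def by (elim exE conjE) (rule that)
  note small = H'[rule_format]
  obtain b where b: "\<And>h. h \<in> H \<Longrightarrow> \<bar>h\<bar> \<le> int b"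
    using finite_int_set_bounded[OF H(1)] by blast
  have fin_g: "finite {s \<in> S. \<forall>h\<in>H. real (overlap (A s) (g - h)) < \<delta> * real s}" (is "finite ?S") for g
  \<comment> \<open>a shift \<open>g\<close> in \<open>H\<close> overlaps itself completely, any other one would enlarge \<open>H\<close>\<close>
  proof (cases "g \<in> H")
    case True
    have "?S \<subseteq> {..<s0}"
    proof
      fix s assume "s \<in> ?S"
      then have "real (overlap (A s) (g - g)) < \<delta> * real s" using True by blast
      then have "real (card (A s)) < \<delta> * real s" by (simp add: overlap_def)
      also have "\<dots> \<le> d * real s" using \<delta> by (intro mult_right_mono) auto
      finally show "s \<in> {..<s0}" using dens by (force simp: not_less[symmetric])
    qed
    then show ?thesis by (rule finite_subset) simp
  next
    case False
    show ?thesis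
    proof (rule ccontr)
      assume inf: "infinite ?S"
      have "P (Suc r)" unfolding P_def
      proof (intro exI conjI ballI impI)
        show "finite (insert g H)" "card (insert g H) = Suc r" using H False by auto
        show "infinite ?S" by fact
        fix s h h' assume "s \<in> ?S" "h \<in> insert g H" "h' \<in> insert g H" "h \<noteq> h'"
        then show "real (overlap (A s) (h - h')) < \<delta> * real s"
          using small[of s h h'] overlap_minus[of "A s" "g - h"] by auto
      qed
      with r show False by simp
    qed
  qed
  show ?thesis
  proof (intro exI[of _ \<delta>] exI[of _ "2 * b"] exI[of _ S] conjI allI \<delta>(1) H(3))
    fix k
    have "{s \<in> S. \<forall>j\<le>2*b. real (overlap (A s) (k + int j)) < \<delta> * real s}
        \<subseteq> {s \<in> S. \<forall>h\<in>H. real (overlap (A s) (k + int b - h)) < \<delta> * real s}"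
    \<comment> \<open>for \<open>g = k + b\<close> and \<open>h\<close> in \<open>H\<close>, the difference \<open>g - h\<close> lies in \<open>{k..k + 2 * b}\<close>\<close>
    proof (rule subsetI, rule CollectI, rule conjI, simp, rule ballI)
      fix s h assume s: "s \<in> {s \<in> S. \<forall>j\<le>2*b. real (overlap (A s) (k + int j)) < \<delta> * real s}"
        and "h \<in> H"
      then have "nat (int b - h) \<le> 2 * b" "k + int (nat (int b - h)) = k + int b - h"
        using b[of h] by auto
      moreover from s have "\<forall>j\<le>2*b. real (overlap (A s) (k + int j)) < \<delta> * real s" by simp
      ultimately show "real (overlap (A s) (k + int b - h)) < \<delta> * real s"
        by (simp only: flip: \<open>k + int (nat (int b - h)) = k + int b - h\<close>)
    qed
    then show "finite {s \<in> S. \<forall>j\<le>2*b. real (overlap (A s) (k + int j)) < \<delta> * real s}"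
      by (rule finite_subset) (rule fin_g)
  qed
qed

text \<open>
  Double counting of the pairs in \<open>A\<close> according to their difference.
\<close>

lemma sum_overlap_le_pair_sum:
  fixes \<mu> :: "int \<Rightarrow> real"
  assumes "finite A" "finite G" "\<And>k. 0 \<le> \<mu> k"
  shows "(\<Sum>k\<in>G. \<mu> k * real (overlap A k)) \<le> (\<Sum>n\<in>A. \<Sum>m\<in>A. \<mu> (m - n))"
proof -
  have "(\<Sum>k\<in>G. \<mu> k * real (overlap A k)) = (\<Sum>k\<in>G. \<Sum>n\<in>A. if n + k \<in> A then \<mu> k else 0)"
    using assms(1) by (intro sum.cong) (auto simp: overlap_def simp flip: sum.inter_filter)
  also have "\<dots> = (\<Sum>n\<in>A. \<Sum>k\<in>G. if n + k \<in> A then \<mu> k else 0)"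
    by (rule sum.swap)
  also have "\<dots> \<le> (\<Sum>n\<in>A. \<Sum>m\<in>A. \<mu> (m - n))"
  proof (rule sum_mono)
    fix n assume "n \<in> A"
    have "(\<Sum>k\<in>G. if n + k \<in> A then \<mu> k else 0) = (\<Sum>k | k \<in> G \<and> n + k \<in> A. \<mu> k)"
      using assms(2) by (simp add: sum.inter_filter)
    also have "\<dots> = (\<Sum>m\<in>(\<lambda>k. n + k) ` {k \<in> G. n + k \<in> A}. \<mu> (m - n))"
      by (subst sum.reindex) (auto simp: inj_on_def)
    also have "\<dots> \<le> (\<Sum>m\<in>A. \<mu> (m - n))"
      using assms by (intro sum_mono2) auto
    finally show "(\<Sum>k\<in>G. if n + k \<in> A then \<mu> k else 0) \<le> (\<Sum>m\<in>A. \<mu> (m - n))" .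
  qed
  finally show ?thesis .
qed

text \<open>
  Adding up the bound \<open>C\<close> over the at most \<open>s\<close> points \<open>n\<close> of \<open>A s\<close> shows that the sum of
  \<open>\<mu> k\<close>, weighted by the number of times that \<open>k\<close> occurs as a difference in \<open>A s\<close>, is at
  most \<open>C * s\<close>.  Frequent differences occur at least
  \<open>\<delta> * s\<close> times, so their total mass is at most \<open>C / \<delta>\<close>; and as they have bounded gaps,
  the growth condition on \<open>\<mu>\<close> compares every \<open>\<mu> k\<close> with the value at a frequent difference
  just above \<open>k\<close>.
\<close>

lemma summable_on_int_if_bounded_on_differences:
  fixes \<mu> :: "int \<Rightarrow> real" and E :: "int set" and A :: "nat \<Rightarrow> int set"
  assumes nonneg: "\<And>k. 0 \<le> \<mu> k"
    and M: "1 \<le> M" "\<And>k. \<mu> k \<le> M * \<mu> (k + 1)"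
    and C: "\<And>n F. n \<in> E \<Longrightarrow> finite F \<Longrightarrow> F \<subseteq> E \<Longrightarrow> (\<Sum>m\<in>F. \<mu> (m - n)) \<le> C"
    and d: "d > 0" and AE: "\<And>s. A s \<subseteq> E" and sub: "\<And>s. A s \<subseteq> {a s + 1..a s + int s}"
    and dens: "\<forall>s\<ge>s0. d * real s \<le> real (card (A s))"
  shows "\<mu> summable_on UNIV"
proof -
  obtain \<delta> K S where \<delta>: "\<delta> > 0" and S: "infinite S" and
    "\<forall>k. finite {s \<in> S. \<forall>j\<le>K. real (overlap (A s) (k + int j)) < \<delta> * real s}"
    using overlaps_bounded_below_syndetically[OF d sub dens] by auto
  note synd = this(3)[rule_format]
  have growth: "\<mu> k \<le> M ^ j * \<mu> (k + int j)" for k j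
  proof (induction j)
    case (Suc j)
    have "\<mu> k \<le> M ^ j * (M * \<mu> (k + int j + 1))"
      using Suc M by (meson mult_left_mono order_trans zero_le_power zero_le_one)
    then show ?case by (simp add: algebra_simps)
  qed simp
  define b where "b = M ^ K * (real (Suc K) * \<bar>C\<bar> / \<delta>)"
  have bound: "sum \<mu> G \<le> b" if G: "finite G" for G
  proof -
    have "finite (\<Union>k\<in>G. {s \<in> S. \<forall>j\<le>K. real (overlap (A s) (k + int j)) < \<delta> * real s})"
      using G synd by blast
    then have "infinite (S - (\<Union>k\<in>G. {s \<in> S. \<forall>j\<le>K. real (overlap (A s) (k + int j)) < \<delta> * real s}) - {0})"
      using S by (simp add: Diff_infinite_finite)
    then obtain s where s': "s \<in> S - (\<Union>k\<in>G. {s \<in> S. \<forall>j\<le>K. real (overlap (A s) (k + int j)) < \<delta> * real s}) - {0}"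
      using infinite_imp_nonempty by blast
    then have s: "s \<in> S" "s \<noteq> 0" by auto
    have ex: "\<exists>j\<le>K. \<delta> * real s \<le> real (overlap (A s) (k + int j))" if "k \<in> G" for k
    proof (rule ccontr)
      assume "\<not> ?thesis"
      then have "\<forall>j\<le>K. real (overlap (A s) (k + int j)) < \<delta> * real s"
        using not_le by blast
      then have "s \<in> {s \<in> S. \<forall>j\<le>K. real (overlap (A s) (k + int j)) < \<delta> * real s}"
        using s by simp
      with s' that show False by blast
    qed
    have fin: "finite (A s)" by (rule finite_subset[OF sub]) simp
    have \<delta>s: "\<delta> * real s > 0" using \<delta> s by simp
    have row: "(\<Sum>k\<in>G. \<mu> (k + int j) * real (overlap (A s) (k + int j))) \<le> real s * \<bar>C\<bar>" for j
    proof -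
      have "(\<Sum>k\<in>G. \<mu> (k + int j) * real (overlap (A s) (k + int j)))
          = (\<Sum>k\<in>(\<lambda>k. k + int j) ` G. \<mu> k * real (overlap (A s) k))"
        by (subst sum.reindex) (auto simp: inj_on_def)
      also have "\<dots> \<le> (\<Sum>n\<in>A s. \<Sum>m\<in>A s. \<mu> (m - n))"
        using G fin nonneg by (intro sum_overlap_le_pair_sum) auto
      also have "\<dots> \<le> (\<Sum>n\<in>A s. \<bar>C\<bar>)"
      proof (rule sum_mono)
        fix n assume "n \<in> A s"
        with C[OF _ fin AE] AE have "(\<Sum>m\<in>A s. \<mu> (m - n)) \<le> C" by blast
        then show "(\<Sum>m\<in>A s. \<mu> (m - n)) \<le> \<bar>C\<bar>" by linarith
      qed
      also have "\<dots> = real (card (A s)) * \<bar>C\<bar>" by simp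
      also have "card (A s) \<le> card {a s + 1..a s + int s}" by (rule card_mono[OF _ sub]) simp
      then have "real (card (A s)) * \<bar>C\<bar> \<le> real s * \<bar>C\<bar>" by (intro mult_right_mono) auto
      finally show ?thesis .
    qed
    have "\<delta> * real s * sum \<mu> G
        \<le> (\<Sum>k\<in>G. M ^ K * (\<Sum>j\<le>K. \<mu> (k + int j) * real (overlap (A s) (k + int j))))"
      unfolding sum_distrib_left
    proof (rule sum_mono, unfold sum_distrib_left[symmetric])
      fix k assume "k \<in> G"
      then obtain j where j: "j \<le> K" "\<delta> * real s \<le> real (overlap (A s) (k + int j))"
        using ex by blast
      have "\<delta> * real s * \<mu> k \<le> \<delta> * real s * (M ^ K * \<mu> (k + int j))"
      proof (rule mult_left_mono)
        have "\<mu> k \<le> M ^ j * \<mu> (k + int j)" by (rule growth)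
        also have "\<dots> \<le> M ^ K * \<mu> (k + int j)"
          using j M nonneg by (intro mult_right_mono power_increasing) auto
        finally show "\<mu> k \<le> M ^ K * \<mu> (k + int j)" .
      qed (use \<delta>s in simp)
      also have "\<dots> = M ^ K * (\<mu> (k + int j) * (\<delta> * real s))" by simp
      also have "\<dots> \<le> M ^ K * (\<mu> (k + int j) * real (overlap (A s) (k + int j)))"
        using j M nonneg by (intro mult_left_mono) auto
      also have "\<mu> (k + int j) * real (overlap (A s) (k + int j))
          \<le> (\<Sum>j\<le>K. \<mu> (k + int j) * real (overlap (A s) (k + int j)))"
        using j nonneg by (intro member_le_sum) auto
      finally show "\<delta> * real s * \<mu> k
          \<le> M ^ K * (\<Sum>j\<le>K. \<mu> (k + int j) * real (overlap (A s) (k + int j)))"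
        using M by (simp add: mult_left_mono)
    qed
    also have "\<dots> = M ^ K * (\<Sum>j\<le>K. \<Sum>k\<in>G. \<mu> (k + int j) * real (overlap (A s) (k + int j)))"
      unfolding sum_distrib_left[symmetric] by (subst sum.swap) simp
    also have "\<dots> \<le> M ^ K * (\<Sum>j\<le>K. real s * \<bar>C\<bar>)"
      using M row by (intro mult_left_mono sum_mono) auto
    also have "\<dots> = \<delta> * real s * b" using \<delta> by (simp add: b_def field_simps)
    finally show ?thesis using \<delta>s by (simp only: mult_le_cancel_left_pos)
  qed
  show ?thesis
    by (rule nonneg_bdd_above_summable_on) (auto intro!: nonneg bdd_aboveI2[where M = b] bound)
qed

section \<open>Comparison of densities\<close>

lemma upper_banach_density_pos_imp_dense_intervals:
  assumes "upper_banach_density A > 0"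
  shows "\<exists>d>0. \<exists>s0. \<forall>s\<ge>s0. \<exists>k. d * real s \<le> real (card (A \<inter> {k + 1..k + s}))"
proof -
  obtain d where d: "0 < ereal d" "ereal d < upper_banach_density A"
    using assms by (meson ereal_dense2)
  have "eventually (\<lambda>s. ereal d < banach_count A s / ereal (real s)) sequentially"
    using order_tendstoD(1)[OF upper_banach_density_limit d(2)] .
  then obtain s0 where s0: "\<And>s. s \<ge> s0 \<Longrightarrow> ereal d < banach_count A s / ereal (real s)"
    unfolding eventually_sequentially by blast
  have "\<exists>k. d * real s \<le> real (card (A \<inter> {k + 1..k + s}))" if s: "s \<ge> Suc s0" for s
  proof -
    have "ereal (d * real s) < banach_count A s"
      using s0[of s] s by (cases "banach_count A s") (auto simp: field_simps)
    then obtain k where "ereal (d * real s) < ereal (real (card (A \<inter> {k + 1..k + s})))"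
      unfolding banach_count_def using Limsup_obtain by blast
    then show ?thesis by (intro exI[of _ k]) simp
  qed
  with d show ?thesis by auto
qed

lemma card_Int_initial_segment_le:
  assumes "\<And>k. k \<ge> k0 \<Longrightarrow> real (card (A \<inter> {k + 1..k + s})) \<le> a"
  shows "real (card (A \<inter> {0..k0 + t * s})) \<le> real k0 + 1 + real t * a"
proof (induction t)
  case 0
  have "card (A \<inter> {0..k0}) \<le> card {0..k0}" by (rule card_mono) auto
  then show ?case by simp
next
  case (Suc t)
  have "A \<inter> {0..k0 + Suc t * s} = (A \<inter> {0..k0 + t * s}) \<union> (A \<inter> {(k0 + t * s) + 1..(k0 + t * s) + s})"
    by auto
  then have "card (A \<inter> {0..k0 + Suc t * s})
      \<le> card (A \<inter> {0..k0 + t * s}) + card (A \<inter> {(k0 + t * s) + 1..(k0 + t * s) + s})"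
    by (simp only: card_Un_le)
  then show ?case using Suc assms[of "k0 + t * s"] by (simp add: algebra_simps)
qed

text \<open>
  If windows of length \<open>s\<close> far out contained at most \<open>a < c * s\<close> points, cutting a long initial
  segment into such windows would make its density at most \<open>a / s\<close> asymptotically.
\<close>

lemma lower_density_le_banach_count:
  assumes c: "ereal c < lower_density A" "c > 0" and s: "s > 0"
  shows "ereal (c * real s) \<le> banach_count A s"
proof (rule ccontr)
  assume "\<not> ?thesis"
  then have "banach_count A s < ereal (c * real s)" by simp
  then obtain a where a: "banach_count A s < ereal a" "ereal a < ereal (c * real s)"
    using ereal_dense2 by blast
  have "eventually (\<lambda>k. ereal (real (card (A \<inter> {k + 1..k + s}))) < ereal a) sequentially"
    using a(1) unfolding banach_count_def by (rule Limsup_lessD)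
  moreover have "eventually (\<lambda>k. ereal c < ereal (real (card (A \<inter> {0..k})) / real k)) sequentially"
    using c(1) unfolding lower_density_def by (rule less_LiminfD)
  ultimately have "eventually (\<lambda>k. real (card (A \<inter> {k + 1..k + s})) \<le> a
      \<and> c < real (card (A \<inter> {0..k})) / real k) sequentially"
    by eventually_elim simp
  then obtain k0 where k0: "\<And>k. k \<ge> k0 \<Longrightarrow> real (card (A \<inter> {k + 1..k + s})) \<le> a"
      "\<And>k. k \<ge> k0 \<Longrightarrow> c < real (card (A \<inter> {0..k})) / real k"
    unfolding eventually_sequentially by blast
  obtain t :: nat where t: "real t > (real k0 + 1) / (c * real s - a)" "t > 0"
    using reals_Archimedean2[of "max 0 ((real k0 + 1) / (c * real s - a))"] by auto
  have "c * real (k0 + t * s) \<le> real (card (A \<inter> {0..k0 + t * s}))"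
    using k0(2)[of "k0 + t * s"] s t by (simp add: pos_less_divide_eq del: of_nat_add of_nat_mult)
  also have "\<dots> \<le> real k0 + 1 + real t * a"
    by (rule card_Int_initial_segment_le[OF k0(1)])
  finally have "real t * (c * real s - a) \<le> real k0 + 1 - c * real k0"
    by (simp add: algebra_simps)
  moreover have "real k0 + 1 < real t * (c * real s - a)"
    using t a by (simp add: pos_divide_less_eq)
  moreover have "0 \<le> c * real k0" using c by simp
  ultimately show False by linarith
qed

lemma lower_density_pos_imp_upper_banach_density_pos:
  assumes "lower_density A > 0"
  shows "upper_banach_density A > 0"
proof -
  obtain c where c: "0 < ereal c" "ereal c < lower_density A"
    using assms ereal_dense2 by blast
  have "eventually (\<lambda>s. ereal c \<le> banach_count A s / ereal (real s)) sequentially"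
    using eventually_gt_at_top[of 0]
  proof eventually_elim
    case (elim s)
    with lower_density_le_banach_count[OF c(2) _ elim] c show ?case
      by (cases "banach_count A s") (auto simp: field_simps)
  qed
  then have "ereal c \<le> upper_banach_density A"
    by (rule tendsto_lowerbound[OF upper_banach_density_limit]) simp
  then show ?thesis by (rule less_le_trans[OF c(1)[unfolded zero_ereal_def[symmetric]]])
qed

section \<open>Separated sets of positive lower density\<close>

lemma lower_density_range_pos:
  fixes f :: "nat \<Rightarrow> nat"
  assumes "inj f" and le: "\<And>j. f j \<le> c * j + b" and c: "c > 0"
  shows "lower_density (range f) > 0"
proof -
  have "eventually (\<lambda>k. ereal (1 / (2 * real c))
      \<le> ereal (real (card (range f \<inter> {0..k})) / real k)) sequentially"
    using eventually_ge_at_top[of "2 * b + 1"]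
  proof eventually_elim
    case (elim k)
    define m where "m = (k - b) div c"
    have "f ` {0..m} \<subseteq> range f \<inter> {0..k}"
    proof
      fix x assume "x \<in> f ` {0..m}"
      then obtain j where j: "x = f j" "j \<le> m" by auto
      have "f j \<le> c * m + b" using le[of j] mult_le_mono2[OF j(2), of c] by linarith
      also have "c * m \<le> k - b" unfolding m_def by simp
      finally show "x \<in> range f \<inter> {0..k}" using j elim by simp
    qed
    then have "card (f ` {0..m}) \<le> card (range f \<inter> {0..k})" by (intro card_mono) auto
    moreover have "card (f ` {0..m}) = Suc m"
      using card_image[OF inj_on_subset[OF assms(1)], of "{0..m}"] by simp
    moreover have "k - b \<le> c * Suc m"
      unfolding m_def using c dividend_less_div_times[of c "k - b"] by (simp add: algebra_simps)
    ultimately have "k - b \<le> c * card (range f \<inter> {0..k})"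
      using mult_le_mono2 order_trans by metis
    then have "k \<le> 2 * (c * card (range f \<inter> {0..k}))" using elim by linarith
    then have "real k \<le> 2 * (real c * real (card (range f \<inter> {0..k})))"
      using of_nat_mono by fastforce
    then show ?case using elim c by (simp add: field_simps)
  qed
  then have "ereal (1 / (2 * real c)) \<le> lower_density (range f)"
    unfolding lower_density_def by (rule Liminf_bounded)
  then show ?thesis by (rule less_le_trans[rotated]) (use c in simp)
qed

lemma card_multiples_le:
  fixes q :: nat
  assumes "q > 0"
  shows "card {i \<in> {1..k}. q dvd i} \<le> k div q"
proof -
  have "card {i \<in> {1..k}. q dvd i} \<le> card {1..k div q}"
  proof (rule card_inj_on_le[of "\<lambda>i. i div q"])
    show "inj_on (\<lambda>i. i div q) {i \<in> {1..k}. q dvd i}"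
      using assms by (auto simp: inj_on_def)
    show "(\<lambda>i. i div q) ` {i \<in> {1..k}. q dvd i} \<subseteq> {1..k div q}"
    proof
      fix y assume "y \<in> (\<lambda>i. i div q) ` {i \<in> {1..k}. q dvd i}"
      then obtain i where i: "i \<in> {1..k}" "q dvd i" "y = i div q" by auto
      then obtain c where c: "i = q * c" by auto
      then have "y = c" "c \<ge> 1" using i assms by (auto intro: Suc_leI Nat.gr0I)
      moreover have "y \<le> k div q" using i by (simp add: div_le_mono)
      ultimately show "y \<in> {1..k div q}" by simp
    qed
  qed simp
  then show ?thesis by simp
qed

text \<open>
  Positions are placed one after the other on a line.  Position number \<open>k\<close> claims a
  neighbourhood of radius \<open>g k\<close>, where \<open>g k\<close> is at least \<open>\<rho> l\<close> whenever
  \<open>q l\<close> divides \<open>k\<close>, and consecutive neighbourhoods touch.  Since \<open>q l\<close> exceeds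
  \<open>2 ^ l * \<rho> l\<close>, the radii have bounded mean and position number \<open>k\<close> is at most \<open>2 * k\<close>.  The
  numbers congruent to \<open>q l\<close> modulo \<open>q (Suc l)\<close> therefore have positions of
  positive lower density, and since the \<open>q l\<close> form a chain for divisibility, these progressions are
  disjoint for different \<open>l\<close>.
\<close>

lemma separated_sets_of_positive_lower_density:
  fixes \<rho> :: "nat \<Rightarrow> nat"
  assumes \<rho>: "\<And>l. 1 \<le> \<rho> l"
  obtains A :: "nat \<Rightarrow> nat set" where
    "\<And>l. lower_density (A l) > 0"
    "\<And>l n. n \<in> A l \<Longrightarrow> \<rho> l \<le> n"
    "\<And>l l' n n'. n \<in> A l \<Longrightarrow> n' \<in> A l' \<Longrightarrow> (l, n) \<noteq> (l', n') \<Longrightarrow>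
      int (\<rho> l + \<rho> l') \<le> \<bar>int n - int n'\<bar>"
proof -
  define q where "q l = (\<Prod>i\<le>l. 2 * Suc (\<rho> i))" for l
  have q_Suc: "q (Suc l) = q l * (2 * Suc (\<rho> (Suc l)))" for l by (simp add: q_def)
  have q_ge: "2 ^ Suc l * Suc (\<rho> l) \<le> q l" for l
  proof (induction l)
    case (Suc l)
    have "2 ^ Suc l \<le> q l" using Suc by (rule order_trans[rotated]) simp
    then have "2 ^ Suc l * (2 * Suc (\<rho> (Suc l))) \<le> q l * (2 * Suc (\<rho> (Suc l)))"
      by (rule mult_le_mono1)
    then show ?case by (simp only: q_Suc power_Suc ac_simps)
  qed (simp add: q_def)
  have q_pow: "2 ^ Suc l \<le> q l" for l using q_ge[of l] by (rule order_trans[rotated]) simp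
  then have q_pos: "q l > 0" for l by (rule less_le_trans[rotated]) simp
  have q_gt: "l < q l" for l
  proof -
    have "l < 2 ^ Suc l" using less_exp[of "Suc l"] by (rule Suc_lessD)
    then show ?thesis using q_pow by (rule less_le_trans)
  qed
  have q_less: "q l < q (Suc l)" for l using q_pos[of l] by (simp add: q_Suc)
  have q_dvd: "l \<le> l' \<Longrightarrow> q l dvd q l'" for l l'
    by (induction l' rule: dec_induct) (auto simp: q_Suc)
  define g where "g i = (\<Sum>l\<le>i. if q l dvd i then \<rho> l else 0)" for i
  define S where "S k = (\<Sum>i=1..k. g i)" for k
  \<comment> \<open>midpoints of consecutive intervals of lengths \<open>2 * g 1\<close>, \<open>2 * g 2\<close>, and so on\<close>
  define pos where "pos k = 2 * S (k - 1) + g k" for k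
  have S_Suc: "S (Suc k) = S k + g (Suc k)" for k by (simp add: S_def)
  have S_le: "S k \<le> k" for k
  proof -
    have "real (S k) = (\<Sum>i=1..k. \<Sum>l\<le>i. if q l dvd i then real (\<rho> l) else 0)"
      unfolding S_def g_def of_nat_sum by (intro sum.cong refl) auto
    also have "\<dots> \<le> (\<Sum>i=1..k. \<Sum>l\<le>k. if q l dvd i then real (\<rho> l) else 0)"
      by (intro sum_mono sum_mono2) auto
    also have "\<dots> = (\<Sum>l\<le>k. \<Sum>i=1..k. if q l dvd i then real (\<rho> l) else 0)"
      by (rule sum.swap)
    also have "\<dots> = (\<Sum>l\<le>k. real (card {i \<in> {1..k}. q l dvd i}) * real (\<rho> l))"
      by (simp flip: sum.inter_filter)
    also have "\<dots> \<le> (\<Sum>l\<le>k. real k * (1 / 2) ^ Suc l)"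
    proof (rule sum_mono)
      fix l
      have "real (card {i \<in> {1..k}. q l dvd i}) \<le> real (k div q l)"
        using card_multiples_le[OF q_pos] by (simp only: of_nat_le_iff)
      also have "\<dots> \<le> real k / real (q l)" by (rule of_nat_div_le_of_nat)
      finally have "real (card {i \<in> {1..k}. q l dvd i}) * real (\<rho> l)
          \<le> real k / real (q l) * real (\<rho> l)" by (rule mult_right_mono) simp
      also have "\<dots> = real k * (real (\<rho> l) / real (q l))" by simp
      also have "real (\<rho> l) / real (q l) \<le> (1 / 2) ^ Suc l"
      proof -
        have "2 ^ Suc l * \<rho> l \<le> q l" using q_ge[of l] by (rule order_trans[rotated]) simp
        then have "real (2 ^ Suc l * \<rho> l) \<le> real (q l)" by (simp only: of_nat_le_iff)
        then show ?thesis using q_pos[of l] by (simp add: field_simps)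
      qed
      finally show "real (card {i \<in> {1..k}. q l dvd i}) * real (\<rho> l) \<le> real k * (1 / 2) ^ Suc l"
        by (simp add: mult_left_mono)
    qed
    also have "\<dots> = real k * (\<Sum>l\<le>k. (1 / 2) ^ Suc l)" by (simp only: sum_distrib_left)
    also have "\<dots> \<le> real k * 1"
    proof (rule mult_left_mono)
      have "(\<Sum>l\<le>k. (1 / 2 :: real) ^ Suc l) = 1 - (1 / 2) ^ Suc k"
        by (induction k) (simp_all add: field_simps)
      then show "(\<Sum>l\<le>k. (1 / 2 :: real) ^ Suc l) \<le> 1" by simp
    qed simp
    finally show ?thesis by simp
  qed
  have pos_le: "pos k \<le> 2 * k" if "k > 0" for k
  proof -
    from that obtain j where "k = Suc j" by (cases k) auto
    then have "pos k \<le> 2 * S k" by (simp add: pos_def S_Suc)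
    with S_le[of k] show ?thesis by simp
  qed
  have pos_gap: "pos k + (g k + g k') \<le> pos k'" if "0 < k" "k < k'" for k k'
  proof -
    have "S k \<le> S (k' - 1)" unfolding S_def using that by (intro sum_mono2) auto
    moreover have "S k = S (k - 1) + g k" using that S_Suc[of "k - 1"] by simp
    ultimately show ?thesis by (simp add: pos_def)
  qed
  define idx where "idx l j = q l + q (Suc l) * j" for l j
  have idx_pos: "idx l j > 0" for l j using q_pos[of l] by (simp add: idx_def)
  have idx_dvd: "q l dvd idx l j" for l j
    using q_dvd[of l "Suc l"] by (simp add: idx_def)
  have idx_less: "idx l j \<noteq> idx l' j'" if "l < l'" for l l' j j'
  proof
    assume "idx l j = idx l' j'"
    then have "q l' dvd idx l j" using idx_dvd[of l' j'] by simp
    then have "q (Suc l) dvd idx l j" using q_dvd[of "Suc l" l'] that by (meson Suc_leI dvd_trans)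
    then have "q (Suc l) dvd q l" by (simp add: idx_def dvd_add_left_iff)
    then show False using q_less[of l] q_pos[of l] by (simp add: nat_dvd_not_less)
  qed
  have g_idx: "\<rho> l \<le> g (idx l j)" for l j
  proof -
    have "l \<le> idx l j" using q_gt[of l] by (simp add: idx_def)
    then have "(if q l dvd idx l j then \<rho> l else 0) \<le> g (idx l j)"
      unfolding g_def by (intro member_le_sum) auto
    with idx_dvd[of l j] show ?thesis by simp
  qed
  have gap: "int (\<rho> l + \<rho> l') \<le> \<bar>int (pos (idx l j)) - int (pos (idx l' j'))\<bar>"
    if "idx l j \<noteq> idx l' j'" for l l' j j'
  proof (cases "idx l j < idx l' j'")
    case True
    with pos_gap[OF idx_pos True] g_idx[of l j] g_idx[of l' j'] show ?thesis by linarith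
  next
    case False
    with that have "idx l' j' < idx l j" by simp
    with pos_gap[OF idx_pos this] g_idx[of l j] g_idx[of l' j'] show ?thesis by linarith
  qed
  have idx_inj: "idx l j = idx l j' \<longleftrightarrow> j = j'" for l j j'
    using q_pos[of "Suc l"] by (simp add: idx_def)
  show ?thesis
  proof (rule that[of "\<lambda>l. range (\<lambda>j. pos (idx l j))"])
    fix l
    have "inj (\<lambda>j. pos (idx l j))"
    proof (rule injI, rule ccontr)
      fix j j' assume "pos (idx l j) = pos (idx l j')" "j \<noteq> j'"
      with gap[of l j l j'] idx_inj[of l j j'] \<rho>[of l] show False by simp
    qed
    moreover have "pos (idx l j) \<le> (2 * q (Suc l)) * j + 2 * q l" for j
      using pos_le[OF idx_pos, of l j] by (simp add: idx_def)
    ultimately show "lower_density (range (\<lambda>j. pos (idx l j))) > 0"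
      by (rule lower_density_range_pos) (simp add: q_pos)
  next
    fix l n assume "n \<in> range (\<lambda>j. pos (idx l j))"
    then obtain j where "n = pos (idx l j)" by auto
    then show "\<rho> l \<le> n" using g_idx[of l j] by (simp add: pos_def)
  next
    fix l l' n n'
    assume n: "n \<in> range (\<lambda>j. pos (idx l j))" "n' \<in> range (\<lambda>j. pos (idx l' j))"
      and ne: "(l, n) \<noteq> (l', n')"
    then obtain j j' where j: "n = pos (idx l j)" "n' = pos (idx l' j')" by auto
    have "idx l j \<noteq> idx l' j'"
    proof (cases l l' rule: linorder_cases)
      case less
      then show ?thesis by (rule idx_less)
    next
      case equal
      with ne j show ?thesis by auto
    next
      case greater
      then show ?thesis by (rule idx_less[symmetric])
    qed
    then show "int (\<rho> l + \<rho> l') \<le> \<bar>int n - int n'\<bar>" unfolding j by (rule gap)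
  qed
qed

section \<open>Approximation and orbits in $\ell^p$\<close>

lemma infsum_complement_small:
  fixes f :: "'i \<Rightarrow> real"
  assumes f: "f summable_on UNIV" and e: "e > 0"
  obtains F where "finite F" "infsum f (- F) \<le> e"
proof -
  obtain F where F: "finite F" "dist (sum f F) (infsum f UNIV) \<le> e"
    using infsum_finite_approximation[OF f e] by auto
  have "infsum f UNIV = infsum f F + infsum f (- F)"
    using infsum_Un_disjoint[of f F "- F"] f F(1)
    by (simp add: summable_on_subset_banach[OF f])
  then have "infsum f (- F) \<le> e" using F by (simp add: dist_real_def)
  with F(1) show ?thesis by (rule that)
qed

text \<open>
  Choose finite sets \<open>G j\<close> that carry all but \<open>(1 / 2) ^ j\<close> of the mass.  If an index is
  weighted by the number of the \<open>G j\<close> that miss it, the weighted sum is at most the sum of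
  the \<open>(1 / 2) ^ j\<close> (du Bois-Reymond).
\<close>

lemma summable_with_divergent_weight:
  fixes f :: "'i::countable \<Rightarrow> real"
  assumes f: "f summable_on UNIV" and nonneg: "\<And>i. 0 \<le> f i"
  obtains \<psi> :: "'i \<Rightarrow> real" where "\<And>i. 0 \<le> \<psi> i" "(\<lambda>i. f i * \<psi> i) summable_on UNIV"
    "\<And>b. finite {i. \<psi> i < b}"
proof -
  have "\<exists>F. finite F \<and> infsum f (- F) \<le> (1 / 2) ^ j" for j :: nat
    using infsum_complement_small[OF f, of "(1 / 2) ^ j"] by auto
  then obtain F where F: "\<And>j. finite (F j)" "\<And>j. infsum f (- F j) \<le> (1 / 2) ^ j" by metis
  define G where "G j = F j \<union> {i. to_nat i \<le> j}" for j
  have G: "finite (G j)" for j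
    using F(1) finite_vimageI[OF finite_atMost inj_to_nat, of j] by (simp add: G_def vimage_def)
  define \<psi> where "\<psi> i = real (card {j. i \<notin> G j})" for i
  have fin: "finite {j. i \<notin> G j}" for i
    by (rule finite_subset[of _ "{..<to_nat i}"]) (auto simp: G_def)
  have bound: "(\<Sum>i\<in>H. f i * \<psi> i) \<le> 2" if H: "finite H" for H
  proof -
    obtain N where N: "\<And>i. i \<in> H \<Longrightarrow> to_nat i < N"
      using finite_nat_set_iff_bounded[of "to_nat ` H"] H by auto
    have "\<psi> i = (\<Sum>j<N. if i \<notin> G j then 1 else 0)" if "i \<in> H" for i
    proof -
      have "{j. i \<notin> G j} = {j \<in> {..<N}. i \<notin> G j}" using N[OF that] by (auto simp: G_def)
      then show ?thesis by (simp add: \<psi>_def flip: sum.inter_filter)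
    qed
    then have "(\<Sum>i\<in>H. f i * \<psi> i) = (\<Sum>i\<in>H. \<Sum>j<N. if i \<notin> G j then f i else 0)"
      by (intro sum.cong) (auto simp: sum_distrib_left intro!: sum.cong)
    also have "\<dots> = (\<Sum>j<N. \<Sum>i\<in>H. if i \<notin> G j then f i else 0)" by (rule sum.swap)
    also have "\<dots> \<le> (\<Sum>j<N. (1 / 2) ^ j)"
    proof (rule sum_mono)
      fix j
      have "(\<Sum>i\<in>H. if i \<notin> G j then f i else 0) = sum f {i \<in> H. i \<notin> G j}"
        using H by (rule sum.inter_filter[symmetric])
      also have "\<dots> \<le> infsum f (- F j)"
        using H nonneg by (intro finite_sum_le_infsum summable_on_subset_banach[OF f])
          (auto simp: G_def)
      finally show "(\<Sum>i\<in>H. if i \<notin> G j then f i else 0) \<le> (1 / 2) ^ j" using F(2)[of j] by simp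
    qed
    also have "\<dots> \<le> 2"
    proof -
      have "(\<Sum>j<N. (1 / 2 :: real) ^ j) = 2 - 2 * (1 / 2) ^ N" by (induction N) simp_all
      then show ?thesis by simp
    qed
    finally show ?thesis .
  qed
  show ?thesis
  proof (rule that[of \<psi>])
    show "0 \<le> \<psi> i" for i by (simp add: \<psi>_def)
    show "(\<lambda>i. f i * \<psi> i) summable_on UNIV"
    proof (rule nonneg_bdd_above_summable_on)
      show "0 \<le> f i * \<psi> i" for i using nonneg by (simp add: \<psi>_def)
      show "bdd_above (sum (\<lambda>i. f i * \<psi> i) ` {F. F \<subseteq> UNIV \<and> finite F})"
        by (rule bdd_aboveI2[where M = 2]) (simp add: bound)
    qed
    fix b :: real
    obtain B :: nat where B: "b \<le> real B" using real_arch_simple by blast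
    have "{i. \<psi> i < b} \<subseteq> (\<Union>j<B. G j)"
    proof (rule subsetI, rule ccontr)
      fix i assume i: "i \<in> {i. \<psi> i < b}" "i \<notin> (\<Union>j<B. G j)"
      then have "{..<B} \<subseteq> {j. i \<notin> G j}" by auto
      then have "card {..<B} \<le> card {j. i \<notin> G j}" by (rule card_mono[OF fin])
      with i B show False by (simp add: \<psi>_def)
    qed
    then show "finite {i. \<psi> i < b}" by (rule finite_subset) (simp add: G)
  qed
qed

lemma lp_space_finite_support:
  assumes "finite {i. u i \<noteq> 0}"
  shows "u \<in> lp_space p"
  unfolding lp_space_def mem_Collect_eq
  by (rule finite_nonzero_values_imp_summable_on) (use assms in simp)

lemma lp_norm_less:
  assumes "1 \<le> p" "(\<Sum>\<^sub>\<infinity>i. norm (x i) powr p) < \<epsilon> powr p" "0 < \<epsilon>"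
  shows "lp_norm p x < \<epsilon>"
proof -
  have "lp_norm p x < (\<epsilon> powr p) powr (1 / p)"
    unfolding lp_norm_def using assms by (intro powr_less_mono2 infsum_nonneg) auto
  then show ?thesis using assms by (simp add: powr_powr)
qed

text \<open>
  Lists over a countable dense set of scalars are countably many, and they code
  the finitely supported sequences used for approximation; the indices are enumerated by
  \<^const>\<open>to_nat\<close>.
\<close>

definition seq_of_list :: "'k::zero list \<Rightarrow> 'i::countable \<Rightarrow> 'k" where
  "seq_of_list xs i = (if to_nat i < length xs then xs ! to_nat i else 0)"

lemma finite_initial: "finite {i :: 'i::countable. to_nat i < N}"
  using finite_vimageI[OF finite_lessThan inj_to_nat, of N] by (simp add: vimage_def)

lemma finite_support_seq_of_list: "finite {i. seq_of_list xs i \<noteq> 0}"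
  by (rule finite_subset[OF _ finite_initial[of "length xs"]]) (auto simp: seq_of_list_def)

lemma seq_of_list_dense:
  fixes a :: "'i::countable \<Rightarrow> 'k::{real_normed_field,euclidean_space}"
  assumes p: "1 \<le> p" and a: "a \<in> lp_space p" and \<epsilon>: "0 < \<epsilon>"
    and D: "\<And>X. open X \<Longrightarrow> X \<noteq> {} \<Longrightarrow> \<exists>d\<in>D. d \<in> X"
  shows "\<exists>xs\<in>lists D. lp_dist p (seq_of_list xs) a < \<epsilon>"
proof -
  define \<eta> where "\<eta> = \<epsilon> powr p / 3"
  have \<eta>: "\<eta> > 0" using \<epsilon> by (simp add: \<eta>_def)
  have sm: "(\<lambda>i. norm (a i) powr p) summable_on UNIV" using a by (simp add: lp_space_def)
  obtain F where F: "finite F" "(\<Sum>\<^sub>\<infinity>i\<in>- F. norm (a i) powr p) \<le> \<eta>"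
    using infsum_complement_small[OF sm \<eta>] by blast
  obtain N where N: "\<And>i. i \<in> F \<Longrightarrow> to_nat i < N"
    using finite_nat_set_iff_bounded[of "to_nat ` F"] F(1) by auto
  define I :: "'i set" where "I = {i. to_nat i < N}"
  have I: "finite I" unfolding I_def by (rule finite_initial)
  define \<delta> where "\<delta> = (\<eta> / real (Suc (card I))) powr (1 / p)"
  have \<delta>: "\<delta> > 0" "\<delta> powr p = \<eta> / real (Suc (card I))"
    using \<eta> p by (auto simp: \<delta>_def powr_powr)
  have "\<exists>d\<in>D. dist d (a i) < \<delta>" for i
    using D[of "ball (a i) \<delta>"] \<delta> by (auto simp: dist_commute)
  then obtain c where c: "\<And>i. c i \<in> D" "\<And>i. dist (c i) (a i) < \<delta>" by metis
  define xs where "xs = map (\<lambda>n. c (from_nat n)) [0..<N]"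
  have xs: "seq_of_list xs i = (if i \<in> I then c i else 0)" for i
    by (simp add: seq_of_list_def xs_def I_def)
  have "(\<lambda>i. seq_of_list xs i - a i) \<in> lp_space p"
    by (intro lp_space_diff p a lp_space_finite_support finite_support_seq_of_list)
  then have "(\<Sum>\<^sub>\<infinity>i. norm (seq_of_list xs i - a i) powr p) \<le> \<eta> + \<eta>"
    unfolding lp_space_def mem_Collect_eq
  proof (rule infsum_le_finite_sums)
    fix H :: "'i set" assume H: "finite H"
    have "(\<Sum>i\<in>H. norm (seq_of_list xs i - a i) powr p)
        = (\<Sum>i\<in>H \<inter> I. norm (seq_of_list xs i - a i) powr p)
          + (\<Sum>i\<in>H - I. norm (seq_of_list xs i - a i) powr p)"
      using H by (simp add: sum.Int_Diff)
    also have "(\<Sum>i\<in>H \<inter> I. norm (seq_of_list xs i - a i) powr p) \<le> (\<Sum>i\<in>H \<inter> I. \<delta> powr p)"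
      using c(2) p by (intro sum_mono powr_mono2) (auto simp: xs dist_norm intro: less_imp_le)
    also have "\<dots> \<le> \<eta>"
    proof -
      have "real (card (H \<inter> I)) \<le> real (Suc (card I))"
        using card_mono[OF I, of "H \<inter> I"] by simp
      then have "real (card (H \<inter> I)) * (\<eta> / real (Suc (card I)))
          \<le> real (Suc (card I)) * (\<eta> / real (Suc (card I)))"
        using \<eta> by (intro mult_right_mono) auto
      then show ?thesis using \<delta>(2) by simp
    qed
    also have "(\<Sum>i\<in>H - I. norm (seq_of_list xs i - a i) powr p) = (\<Sum>i\<in>H - I. norm (a i) powr p)"
      by (intro sum.cong) (auto simp: xs)
    also have "\<dots> \<le> (\<Sum>\<^sub>\<infinity>i\<in>- F. norm (a i) powr p)"
      using H N by (intro finite_sum_le_infsum summable_on_subset_banach[OF sm]) (auto simp: I_def)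
    also have "\<dots> \<le> \<eta>" by (rule F(2))
    finally show "(\<Sum>i\<in>H. norm (seq_of_list xs i - a i) powr p) \<le> \<eta> + \<eta>" by simp
  qed
  also have "\<dots> < \<epsilon> powr p" using \<epsilon> by (simp add: \<eta>_def)
  finally have "lp_dist p (seq_of_list xs) a < \<epsilon>"
    unfolding lp_dist_def using p \<epsilon> by (intro lp_norm_less)
  moreover have "xs \<in> lists D" using c(1) by (auto simp: xs_def)
  ultimately show ?thesis by blast
qed

text \<open>
  Every element of the dense set occurs at arbitrarily late positions, so that an approximation whose
  quality depends on the position can be made as good as required.
\<close>

lemma lp_dense_sequence:
  fixes p :: real
  assumes p: "1 \<le> p"
  obtains u :: "nat \<Rightarrow> 'i::countable \<Rightarrow> 'k::{real_normed_field,euclidean_space}"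
  where "\<And>l. finite {i. u l i \<noteq> 0}"
    "\<And>a \<epsilon> N. a \<in> lp_space p \<Longrightarrow> 0 < \<epsilon> \<Longrightarrow> \<exists>l\<ge>N. lp_dist p (u l) a < \<epsilon>"
proof -
  obtain D :: "'k set" where D: "countable D" "\<And>X. open X \<Longrightarrow> X \<noteq> {} \<Longrightarrow> \<exists>d\<in>D. d \<in> X"
    using countable_dense_setE by blast
  have L: "countable (lists D)" "lists D \<noteq> {}" using D(1) by auto
  define u :: "nat \<Rightarrow> 'i \<Rightarrow> 'k"
    where "u l = seq_of_list (from_nat_into (lists D) (fst (prod_decode l)))" for l
  show ?thesis
  proof (rule that[of u])
    show "finite {i. u l i \<noteq> 0}" for l
      unfolding u_def by (rule finite_support_seq_of_list)
    fix a :: "'i \<Rightarrow> 'k" and \<epsilon> :: real and N :: nat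
    assume "a \<in> lp_space p" "0 < \<epsilon>"
    then obtain xs where xs: "xs \<in> lists D" "lp_dist p (seq_of_list xs) a < \<epsilon>"
      using seq_of_list_dense[OF p _ _ D(2)] by blast
    then obtain m where m: "xs = from_nat_into (lists D) m"
      using from_nat_into_surj[OF L(1)] by metis
    show "\<exists>l\<ge>N. lp_dist p (u l) a < \<epsilon>"
      by (rule exI[of _ "prod_encode (m, N)"])
        (use xs m in \<open>simp add: u_def le_prod_encode_2\<close>)
  qed
qed

lemma lower_density_mono: "A \<subseteq> B \<Longrightarrow> lower_density A \<le> lower_density B"
  unfolding lower_density_def
  by (intro Liminf_mono always_eventually allI)
    (auto intro!: divide_right_mono card_mono simp: of_nat_le_iff)

text \<open>
  The conjugation to the unweighted shift, which makes the orbits explicit.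
\<close>

lemma funpow_weighted_shift_conj:
  fixes v w :: "int \<Rightarrow> 'k::{real_normed_field,euclidean_space}"
  assumes vw: "\<And>k. v k = w (k + 1) * v (k + 1)"
  shows "(weighted_shift w ^^ n) (\<lambda>k. v k * f k) = (\<lambda>k. v k * f (k + int n))"
proof (induction n arbitrary: f)
  case (Suc n)
  have "weighted_shift w (\<lambda>k. v k * f k) = (\<lambda>k. v k * f (k + 1))"
    by (simp add: weighted_shift_def fun_eq_iff flip: mult.assoc vw)
  with Suc.IH[of "\<lambda>k. f (k + 1)"] show ?case
    by (simp add: funpow_Suc_right add_ac del: funpow.simps)
qed simp

lemma openin_lp_topology_iff:
  fixes V :: "('i \<Rightarrow> 'k::{real_normed_field,euclidean_space}) set"
  assumes p: "1 \<le> p"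
  shows "openin (lp_topology p) V \<longleftrightarrow> V \<subseteq> lp_space p \<and>
    (\<forall>a\<in>V. \<exists>\<epsilon>>0. \<forall>y\<in>lp_space p. lp_dist p a y < \<epsilon> \<longrightarrow> y \<in> V)"
proof -
  interpret Metric_space "lp_space p :: ('i \<Rightarrow> 'k) set" "lp_dist p"
    by (rule Metric_space_lp[OF p])
  show ?thesis unfolding lp_topology_def openin_mtopology mball_def by fast
qed

lemma openin_lp_ball:
  fixes a :: "'i \<Rightarrow> 'k::{real_normed_field,euclidean_space}"
  assumes p: "1 \<le> p"
  shows "openin (lp_topology p) {y \<in> lp_space p. a \<in> lp_space p \<and> lp_dist p a y < \<epsilon>}"
proof -
  interpret Metric_space "lp_space p :: ('i \<Rightarrow> 'k) set" "lp_dist p"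
    by (rule Metric_space_lp[OF p])
  show ?thesis
    using openin_mball[of a \<epsilon>] unfolding lp_topology_def mball_def by (simp add: conj_ac)
qed

lemma topspace_lp_topology:
  assumes p: "1 \<le> p"
  shows "topspace (lp_topology p :: ('i \<Rightarrow> 'k::{real_normed_field,euclidean_space}) topology) = lp_space p"
proof -
  interpret Metric_space "lp_space p :: ('i \<Rightarrow> 'k) set" "lp_dist p"
    by (rule Metric_space_lp[OF p])
  show ?thesis unfolding lp_topology_def by (rule topspace_mtopology)
qed

lemma lp_space_comparison:
  assumes "g summable_on UNIV" "\<And>i. norm (x i) powr p \<le> g i"
  shows "x \<in> lp_space p"
  unfolding lp_space_def mem_Collect_eq
  by (rule summable_on_comparison_test[OF assms(1)]) (use assms(2) in auto)

section \<open>Bilateral shifts with summable weights\<close>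

text \<open>
  The separation makes the blocks around the points of the \<open>A l\<close> disjoint, so every
  position belongs to at most one of them.
\<close>

lemma paste_blocks:
  fixes y :: "nat \<Rightarrow> int \<Rightarrow> 'k::zero" and A :: "nat \<Rightarrow> nat set" and r :: "nat \<Rightarrow> nat"
  assumes sep: "\<And>l l' n n'. n \<in> A l \<Longrightarrow> n' \<in> A l' \<Longrightarrow> (l, n) \<noteq> (l', n') \<Longrightarrow>
      int (r l + r l') < \<bar>int n - int n'\<bar>"
  obtains z :: "int \<Rightarrow> 'k" where
    "\<And>l n j. n \<in> A l \<Longrightarrow> \<bar>j\<bar> \<le> int (r l) \<Longrightarrow> z (j + int n) = y l j"
    "\<And>m. z m \<noteq> 0 \<Longrightarrow> \<exists>l n. n \<in> A l \<and> \<bar>m - int n\<bar> \<le> int (r l) \<and> z m = y l (m - int n)"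
proof -
  define Q where "Q m t \<longleftrightarrow> snd t \<in> A (fst t) \<and> \<bar>m - int (snd t)\<bar> \<le> int (r (fst t))" for m t
  define z where "z m = (if \<exists>t. Q m t then let t = SOME t. Q m t in y (fst t) (m - int (snd t)) else 0)" for m
  have uniq: "t = t'" if "Q m t" "Q m t'" for m t t'
  proof (rule ccontr)
    assume "t \<noteq> t'"
    then have "int (r (fst t) + r (fst t')) < \<bar>int (snd t) - int (snd t')\<bar>"
      using that by (intro sep) (auto simp: Q_def prod_eq_iff)
    with that show False by (auto simp: Q_def)
  qed
  have z_eq: "z m = y (fst t) (m - int (snd t))" if "Q m t" for m t
  proof -
    have "(SOME t. Q m t) = t" using that uniq by blast
    moreover have "\<exists>t. Q m t" using that by blast
    ultimately show ?thesis by (simp only: z_def Let_def if_True)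
  qed
  show ?thesis
  proof (rule that[of z])
    fix l n j assume "n \<in> A l" "\<bar>j\<bar> \<le> int (r l)"
    then have "Q (j + int n) (l, n)" by (simp add: Q_def)
    from z_eq[OF this] show "z (j + int n) = y l j" by simp
  next
    fix m assume "z m \<noteq> 0"
    then have "\<exists>t. Q m t" unfolding z_def by presburger
    then obtain t where t: "Q m t" by blast
    show "\<exists>l n. n \<in> A l \<and> \<bar>m - int n\<bar> \<le> int (r l) \<and> z m = y l (m - int n)"
      by (rule exI[of _ "fst t"], rule exI[of _ "snd t"]) (use t z_eq[OF t] in \<open>simp add: Q_def\<close>)
  qed
qed

text \<open>
  In the coordinates of the unweighted shift, the vector \<open>z\<close> carries a copy of a finitely supported
  \<open>y l\<close> around each \<open>n \<in> A l\<close>, where the \<open>u l = v * y l\<close> are dense in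
  \<open>\<ell>\<^sup>p\<close>.  Shifting by such an \<open>n\<close> puts one copy exactly in place.  The other copies may have
  large entries, but each of them only meets positions \<open>k\<close> beyond the radii \<open>R\<close> of both its own
  pattern and \<open>y l\<close>.  There the \<open>p\<close>-th powers of its entries are dominated by a weight \<open>\<psi> k\<close>
  tending to infinity for which \<open>norm (v k) powr p * \<psi> k\<close> is still summable.  So the error is a tail
  of a fixed convergent series.
\<close>

lemma frequently_hypercyclic_bilateral:
  fixes v w :: "int \<Rightarrow> 'k::{real_normed_field,euclidean_space}"
  assumes p: "1 \<le> p" and vw: "\<And>k. v k = w (k + 1) * v (k + 1)" and v0: "\<And>k. v k \<noteq> 0"
    and v: "v \<in> lp_space p"
  shows "frequently_hypercyclic (lp_topology p) (weighted_shift w)"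
proof -
  define \<mu> where "\<mu> k = norm (v k) powr p" for k
  have "\<mu> summable_on UNIV" using v by (simp add: lp_space_def \<mu>_def[abs_def])
  then obtain \<psi> :: "int \<Rightarrow> real" where \<psi>: "\<And>k. 0 \<le> \<psi> k" "(\<lambda>k. \<mu> k * \<psi> k) summable_on UNIV"
      "\<And>b. finite {k. \<psi> k < b}"
    by (rule summable_with_divergent_weight) (auto simp: \<mu>_def)
  have \<mu>\<psi>: "0 \<le> \<mu> k * \<psi> k" for k using \<psi>(1) by (simp add: \<mu>_def)
  obtain u :: "nat \<Rightarrow> int \<Rightarrow> 'k" where u: "\<And>l. finite {k. u l k \<noteq> 0}"
      "\<And>a \<epsilon> N. a \<in> lp_space p \<Longrightarrow> 0 < \<epsilon> \<Longrightarrow> \<exists>l\<ge>N. lp_dist p (u l) a < \<epsilon>"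
    using lp_dense_sequence[OF p] by blast
  define y where "y l k = u l k / v k" for l k
  have "\<exists>r::nat. \<forall>k. u l k \<noteq> 0 \<longrightarrow> \<bar>k\<bar> \<le> int r" for l
    using finite_int_set_bounded[OF u(1)[of l]] by simp
  then obtain r :: "nat \<Rightarrow> nat" where r: "\<And>l k. u l k \<noteq> 0 \<Longrightarrow> \<bar>k\<bar> \<le> int (r l)" by metis
  have "\<exists>R::nat. (\<forall>k j. int R \<le> \<bar>k\<bar> \<longrightarrow> norm (y l j) powr p \<le> \<psi> k) \<and>
      (\<Sum>\<^sub>\<infinity>k\<in>{k. int R \<le> \<bar>k\<bar>}. \<mu> k * \<psi> k) \<le> 1 / real (Suc l)" for l
  proof -
    define b where "b = (\<Sum>j | u l j \<noteq> 0. norm (y l j) powr p)"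
    have b: "norm (y l j) powr p \<le> b" for j
    proof (cases "u l j = 0")
      case True
      then show ?thesis by (simp add: y_def b_def sum_nonneg)
    next
      case False
      then show ?thesis unfolding b_def using u(1) by (intro member_le_sum) auto
    qed
    obtain F where F: "finite F" "(\<Sum>\<^sub>\<infinity>k\<in>- F. \<mu> k * \<psi> k) \<le> 1 / real (Suc l)"
      using infsum_complement_small[OF \<psi>(2), of "1 / real (Suc l)"] by auto
    obtain R where R: "\<forall>k\<in>F \<union> {k. \<psi> k < b}. \<bar>k\<bar> \<le> int R"
      using finite_int_set_bounded[of "F \<union> {k. \<psi> k < b}"] F(1) \<psi>(3) by auto
    show ?thesis
    proof (intro exI[of _ "Suc R"] conjI allI impI)
      fix k j assume "int (Suc R) \<le> \<bar>k\<bar>"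
      with R have "\<not> \<psi> k < b" by force
      with b[of j] show "norm (y l j) powr p \<le> \<psi> k" by simp
    next
      have "(\<Sum>\<^sub>\<infinity>k\<in>{k. int (Suc R) \<le> \<bar>k\<bar>}. \<mu> k * \<psi> k) \<le> (\<Sum>\<^sub>\<infinity>k\<in>- F. \<mu> k * \<psi> k)"
      proof (rule infsum_mono_neutral)
        show "(\<lambda>k. \<mu> k * \<psi> k) summable_on {k. int (Suc R) \<le> \<bar>k\<bar>}"
          "(\<lambda>k. \<mu> k * \<psi> k) summable_on - F"
          by (rule summable_on_subset_banach[OF \<psi>(2)], simp)+
        fix k assume "k \<in> {k. int (Suc R) \<le> \<bar>k\<bar>} - - F"
        with R show "\<mu> k * \<psi> k \<le> 0" by force
      qed (use \<mu>\<psi> in auto)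
      with F(2) show "(\<Sum>\<^sub>\<infinity>k\<in>{k. int (Suc R) \<le> \<bar>k\<bar>}. \<mu> k * \<psi> k) \<le> 1 / real (Suc l)" by linarith
    qed
  qed
  then obtain R :: "nat \<Rightarrow> nat" where R: "\<And>l k j. int (R l) \<le> \<bar>k\<bar> \<Longrightarrow> norm (y l j) powr p \<le> \<psi> k"
      "\<And>l. (\<Sum>\<^sub>\<infinity>k\<in>{k. int (R l) \<le> \<bar>k\<bar>}. \<mu> k * \<psi> k) \<le> 1 / real (Suc l)"
    by metis
  obtain A :: "nat \<Rightarrow> nat set" where A: "\<And>l. lower_density (A l) > 0"
      "\<And>l n. n \<in> A l \<Longrightarrow> R l + r l + 1 \<le> n"
      "\<And>l l' n n'. n \<in> A l \<Longrightarrow> n' \<in> A l' \<Longrightarrow> (l, n) \<noteq> (l', n') \<Longrightarrow>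
        int ((R l + r l + 1) + (R l' + r l' + 1)) \<le> \<bar>int n - int n'\<bar>"
    using separated_sets_of_positive_lower_density[of "\<lambda>l. R l + r l + 1"] by auto
  obtain z :: "int \<Rightarrow> 'k" where z: "\<And>l n j. n \<in> A l \<Longrightarrow> \<bar>j\<bar> \<le> int (r l) \<Longrightarrow> z (j + int n) = y l j"
      "\<And>m. z m \<noteq> 0 \<Longrightarrow> \<exists>l n. n \<in> A l \<and> \<bar>m - int n\<bar> \<le> int (r l) \<and> z m = y l (m - int n)"
    by (rule paste_blocks[of A r y]) (use A(3) in force)+
  have norm_z: "norm (v k * z m) powr p \<le> \<mu> k * \<psi> k"
    if "n \<in> A l" "z m = y l j" "int (R l) \<le> \<bar>k\<bar>" for k m n l j
    using R(1)[OF that(3), of j] that(2) p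
    by (simp add: norm_mult powr_mult \<mu>_def mult_left_mono)
  define x where "x k = v k * z k" for k
  have x: "x \<in> lp_space p"
  proof (rule lp_space_comparison[OF \<psi>(2)])
    fix k
    show "norm (x k) powr p \<le> \<mu> k * \<psi> k"
    proof (cases "z k = 0")
      case False
      then obtain l n where ln: "n \<in> A l" "\<bar>k - int n\<bar> \<le> int (r l)" "z k = y l (k - int n)"
        using z(2) by blast
      with A(2)[OF ln(1)] have "int (R l) \<le> \<bar>k\<bar>" by linarith
      then show ?thesis unfolding x_def by (rule norm_z[OF ln(1,3)])
    qed (simp add: x_def \<mu>\<psi>)
  qed
  have orbit: "(weighted_shift w ^^ n) x = (\<lambda>k. v k * z (k + int n))" for n
    unfolding x_def[abs_def] by (rule funpow_weighted_shift_conj) (rule vw)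
  \<comment> \<open>either the copy of \<open>y l\<close> covers \<open>k\<close>, or \<open>k\<close> is beyond the radii of both copies\<close>
  have close: "norm (v k * z (k + int n) - u l k) powr p
      \<le> (if int (R l) \<le> \<bar>k\<bar> then \<mu> k * \<psi> k else 0)" if n: "n \<in> A l" for n l k
  proof (cases "\<bar>k\<bar> \<le> int (r l)")
    case True
    then have "v k * z (k + int n) = u l k" using z(1)[OF n True] v0 by (simp add: y_def)
    then show ?thesis using \<mu>\<psi> by simp
  next
    case False
    then have uk: "u l k = 0" using r by blast
    show ?thesis
    proof (cases "z (k + int n) = 0")
      case True
      then show ?thesis using \<mu>\<psi> by (simp add: uk)
    next
      case nz: False
      then obtain l' n' where ln: "n' \<in> A l'" "\<bar>k + int n - int n'\<bar> \<le> int (r l')"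
          "z (k + int n) = y l' (k + int n - int n')"
        using z(2) by blast
      have "(l, n) \<noteq> (l', n')" using ln(2) False by auto
      from A(3)[OF n ln(1) this] ln(2) have "int (R l) \<le> \<bar>k\<bar>" "int (R l') \<le> \<bar>k\<bar>" by linarith+
      with norm_z[OF ln(1,3)] show ?thesis by (simp add: uk)
    qed
  qed
  have orbit_close: "(weighted_shift w ^^ n) x \<in> lp_space p"
      "lp_dist p ((weighted_shift w ^^ n) x) (u l) < \<epsilon>"
    if n: "n \<in> A l" and \<epsilon>: "0 < \<epsilon>" "1 / real (Suc l) < \<epsilon> powr p" for n l \<epsilon>
  proof -
    let ?g = "\<lambda>k. if int (R l) \<le> \<bar>k\<bar> then \<mu> k * \<psi> k else 0"
    have g: "?g summable_on UNIV"
      by (rule summable_on_comparison_test[OF \<psi>(2)]) (use \<mu>\<psi> in auto)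
    have d: "(\<lambda>k. v k * z (k + int n) - u l k) \<in> lp_space p"
      by (rule lp_space_comparison[OF g]) (rule close[OF n])
    from lp_space_add[OF p this lp_space_finite_support[OF u(1)[of l]]]
    show "(weighted_shift w ^^ n) x \<in> lp_space p" by (simp add: orbit)
    have "(\<Sum>\<^sub>\<infinity>k. norm (v k * z (k + int n) - u l k) powr p) \<le> infsum ?g UNIV"
      using d g close[OF n] by (intro infsum_mono) (auto simp: lp_space_def)
    also have "\<dots> = (\<Sum>\<^sub>\<infinity>k\<in>{k. int (R l) \<le> \<bar>k\<bar>}. \<mu> k * \<psi> k)"
      by (rule infsum_cong_neutral) auto
    also have "\<dots> < \<epsilon> powr p" using R(2)[of l] \<epsilon>(2) by linarith
    finally show "lp_dist p ((weighted_shift w ^^ n) x) (u l) < \<epsilon>"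
      unfolding lp_dist_def orbit using p \<epsilon>(1) by (intro lp_norm_less)
  qed
  show ?thesis
    unfolding frequently_hypercyclic_def topspace_lp_topology[OF p]
  proof (intro bexI[of _ x] x allI impI)
    fix V :: "(int \<Rightarrow> 'k) set" assume V: "openin (lp_topology p) V \<and> V \<noteq> {}"
    then obtain a where a: "a \<in> V" "a \<in> lp_space p"
      unfolding openin_lp_topology_iff[OF p] by blast
    then obtain \<epsilon> where \<epsilon>: "\<epsilon> > 0" "\<And>b. b \<in> lp_space p \<Longrightarrow> lp_dist p a b < \<epsilon> \<Longrightarrow> b \<in> V"
      using V unfolding openin_lp_topology_iff[OF p] by blast
    obtain N where N: "1 / real (Suc N) < (\<epsilon> / 2) powr p"
      using nat_approx_posE[of "(\<epsilon> / 2) powr p"] \<epsilon>(1) by auto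
    obtain l where l: "l \<ge> N" "lp_dist p (u l) a < \<epsilon> / 2"
      using u(2)[OF a(2), of "\<epsilon> / 2" N] \<epsilon>(1) by auto
    have "1 / real (Suc l) \<le> 1 / real (Suc N)" using l(1) by (intro divide_left_mono) auto
    with N have small: "1 / real (Suc l) < (\<epsilon> / 2) powr p" by linarith
    have "A l \<subseteq> return_times (weighted_shift w) x V"
    proof
      fix n assume n: "n \<in> A l"
      let ?b = "(weighted_shift w ^^ n) x"
      interpret Metric_space "lp_space p :: (int \<Rightarrow> 'k) set" "lp_dist p"
        by (rule Metric_space_lp[OF p])
      note b = orbit_close[OF n _ small]
      have "lp_dist p a ?b \<le> lp_dist p a (u l) + lp_dist p (u l) ?b"
        by (rule triangle) (use a b \<epsilon>(1) lp_space_finite_support[OF u(1)] in auto)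
      also have "\<dots> < \<epsilon>" using l(2) b(2) \<epsilon>(1) commute by (simp add: commute)
      finally have "?b \<in> V" using \<epsilon> b(1) by simp
      then show "n \<in> return_times (weighted_shift w) x V" by (simp add: return_times_def)
    qed
    from lower_density_mono[OF this] A(1)[of l]
    show "lower_density (return_times (weighted_shift w) x V) > 0" by (rule order.strict_trans2[rotated])
  qed
qed

section \<open>Return times and summability of the weights\<close>

lemma sum_powr_le_of_lp_norm_less:
  assumes p: "1 \<le> p" and "x \<in> lp_space p" "lp_norm p x < \<epsilon>" "finite G"
  shows "(\<Sum>i\<in>G. norm (x i) powr p) \<le> \<epsilon> powr p"
proof -
  have "(\<Sum>i\<in>G. norm (x i) powr p) \<le> (\<Sum>\<^sub>\<infinity>i. norm (x i) powr p)"
    using assms by (intro finite_sum_le_infsum) (auto simp: lp_space_def)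
  also have "\<dots> = lp_norm p x powr p" by (rule lp_norm_powr[OF p, symmetric])
  also have "\<dots> \<le> \<epsilon> powr p" using assms lp_norm_nonneg[of p x] by (intro powr_mono2) auto
  finally show ?thesis .
qed

text \<open>
  If \<open>n\<close> is a return time to the ball around \<open>unit_seq 0\<close>, then \<open>z n\<close> is close to 1.
  For two return times \<open>m \<noteq> n\<close>, the orbit at time \<open>n\<close> has the entry \<open>v (m - n) * z m\<close> at
  \<open>m - n\<close>, of norm at least \<open>norm (v (m - n)) / 2\<close>, and all these entries together belong to the
  small distance to \<open>unit_seq 0\<close>.  The set \<open>I\<close> of coordinates on which the distance is measured is
  everything for a bilateral shift, and the half-line \<open>{0..}\<close> for a unilateral one.  The constant 2 is
  the term \<open>m = n\<close> plus the bound \<open>2 powr p * (1 / 2) powr p\<close> for the others in \<open>I\<close>.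
\<close>

lemma bounded_on_return_differences:
  fixes v z :: "int \<Rightarrow> 'k::{real_normed_field,euclidean_space}"
  assumes p: "1 \<le> p" and v1: "v 0 = 1" and "0 \<in> I"
    and near: "\<And>n G. n \<in> E \<Longrightarrow> finite G \<Longrightarrow> G \<subseteq> I \<Longrightarrow>
      (\<Sum>k\<in>G. norm (unit_seq 0 k - v k * z (k + n)) powr p) \<le> (1 / 2) powr p"
    and out: "(\<lambda>k. norm (v k) powr p) summable_on - I"
    and n: "n \<in> E" and F: "finite F" "F \<subseteq> E"
  shows "(\<Sum>m\<in>F. norm (v (m - n)) powr p) \<le> 2 + (\<Sum>\<^sub>\<infinity>k\<in>- I. norm (v k) powr p)"
proof -
  let ?\<mu> = "\<lambda>k. norm (v k) powr p"
  have big: "1 / 2 \<le> norm (z m)" if "m \<in> E" for m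
  proof -
    have "norm (1 - z m) powr p \<le> (1 / 2) powr p"
      using near[OF that, of "{0}"] assms(3) v1 by (simp add: unit_seq_def)
    then have "norm (1 - z m) \<le> 1 / 2"
      using powr_less_mono2[of p "1 / 2" "norm (1 - z m)"] p by (cases "norm (1 - z m) \<le> 1 / 2") auto
    moreover have "norm (1 :: 'k) \<le> norm (1 - z m) + norm (z m)"
      using norm_triangle_ineq[of "1 - z m" "z m"] by simp
    ultimately show ?thesis by simp
  qed
  define G where "G = (\<lambda>m. m - n) ` F"
  have G: "finite G" using F by (simp add: G_def)
  have "(\<Sum>m\<in>F. ?\<mu> (m - n)) = sum ?\<mu> G"
    unfolding G_def by (subst sum.reindex) (auto simp: inj_on_def)
  also have "\<dots> = sum ?\<mu> (G \<inter> - I) + sum ?\<mu> (G \<inter> I)"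
    using sum.Int_Diff[OF G, of ?\<mu> "- I"] by (simp add: Diff_eq)
  also have "sum ?\<mu> (G \<inter> - I) \<le> infsum ?\<mu> (- I)"
    using G out by (intro finite_sum_le_infsum) auto
  also have "sum ?\<mu> (G \<inter> I) \<le> sum ?\<mu> (insert 0 (G \<inter> I - {0}))"
    using G by (intro sum_mono2) auto
  also have "\<dots> = 1 + sum ?\<mu> (G \<inter> I - {0})"
    using G v1 by (subst sum.insert) auto
  also have "sum ?\<mu> (G \<inter> I - {0}) \<le> 1"
  proof -
    have "(1 / 2) powr p * sum ?\<mu> (G \<inter> I - {0})
        \<le> (\<Sum>k\<in>G \<inter> I - {0}. norm (unit_seq 0 k - v k * z (k + n)) powr p)"
      unfolding sum_distrib_left
    proof (rule sum_mono)
      fix k assume k: "k \<in> G \<inter> I - {0}"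
      then have "k + n \<in> E" using F by (auto simp: G_def)
      from big[OF this] have "(1 / 2) powr p \<le> norm (z (k + n)) powr p"
        using p by (intro powr_mono2) auto
      then have "(1 / 2) powr p * ?\<mu> k \<le> norm (z (k + n)) powr p * ?\<mu> k"
        by (rule mult_right_mono) simp
      then show "(1 / 2) powr p * ?\<mu> k \<le> norm (unit_seq 0 k - v k * z (k + n)) powr p"
        using k by (simp add: unit_seq_def norm_mult powr_mult mult.commute)
    qed
    also have "\<dots> \<le> (1 / 2) powr p * 1" using near[OF n, of "G \<inter> I - {0}"] G by auto
    finally show ?thesis by (simp add: mult_le_cancel_left_pos)
  qed
  finally show ?thesis by simp
qed

lemma weights_in_lp_of_return_set:
  fixes v w z :: "int \<Rightarrow> 'k::{real_normed_field,euclidean_space}"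
  assumes p: "1 \<le> p" and v1: "v 0 = 1" and vw: "\<And>k. v k = w (k + 1) * v (k + 1)"
    and M: "\<And>k. norm (w k) \<le> M" and I: "0 \<in> I"
    and near: "\<And>n G. n \<in> N \<Longrightarrow> finite G \<Longrightarrow> G \<subseteq> I \<Longrightarrow>
      (\<Sum>k\<in>G. norm (unit_seq 0 k - v k * z (k + int n)) powr p) \<le> (1 / 2) powr p"
    and out: "(\<lambda>k. norm (v k) powr p) summable_on - I"
    and dens: "upper_banach_density N > 0"
  shows "v \<in> lp_space p"
proof -
  obtain d s0 where d: "d > 0"
    "\<forall>s\<ge>s0. \<exists>k. d * real s \<le> real (card (N \<inter> {k + 1..k + s}))"
    using upper_banach_density_pos_imp_dense_intervals[OF dens] by blast
  obtain \<kappa> where \<kappa>: "\<forall>s\<ge>s0. d * real s \<le> real (card (N \<inter> {\<kappa> s + 1..\<kappa> s + s}))"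
    using d(2) by metis
  let ?A = "\<lambda>s. int ` (N \<inter> {\<kappa> s + 1..\<kappa> s + s})"
  let ?\<mu> = "\<lambda>k. norm (v k) powr p"
  have "?\<mu> summable_on UNIV"
  proof (rule summable_on_int_if_bounded_on_differences[where A = ?A and E = "int ` N"])
    show "0 \<le> ?\<mu> k" "1 \<le> max 1 (M powr p)" for k by auto
    show "?\<mu> k \<le> max 1 (M powr p) * ?\<mu> (k + 1)" for k
    proof -
      have "?\<mu> k = norm (w (k + 1)) powr p * ?\<mu> (k + 1)"
        by (subst vw) (simp add: norm_mult powr_mult)
      also have "norm (w (k + 1)) powr p \<le> max 1 (M powr p)"
        using M[of "k + 1"] p by (intro max.coboundedI2 powr_mono2) auto
      finally show ?thesis by (simp add: mult_right_mono)
    qed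
    show "(\<Sum>m\<in>F. ?\<mu> (m - n)) \<le> 2 + infsum ?\<mu> (- I)"
      if "n \<in> int ` N" "finite F" "F \<subseteq> int ` N" for n F
      by (rule bounded_on_return_differences[OF p v1 I _ out that]) (use near in auto)
    show "0 < d" by (rule d(1))
    show "?A s \<subseteq> int ` N" "?A s \<subseteq> {int (\<kappa> s) + 1..int (\<kappa> s) + int s}" for s by auto
    show "\<forall>s\<ge>s0. d * real s \<le> real (card (?A s))"
      using \<kappa> by (simp add: card_image)
  qed
  then show ?thesis by (simp add: lp_space_def)
qed

lemma lp_space_unit_seq: "unit_seq i \<in> lp_space p"
  by (rule lp_space_finite_support) (simp add: unit_seq_def)

lemma reiteratively_hypercyclic_return_to_unit:
  fixes T :: "('i \<Rightarrow> 'k::{real_normed_field,euclidean_space}) \<Rightarrow> ('i \<Rightarrow> 'k)"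
  assumes p: "1 \<le> p" and \<epsilon>: "0 < \<epsilon>" and rhc: "reiteratively_hypercyclic (lp_topology p) T"
  obtains x where "x \<in> lp_space p"
    "upper_banach_density {n. (T ^^ n) x \<in> lp_space p \<and> lp_dist p (unit_seq i) ((T ^^ n) x) < \<epsilon>} > 0"
proof -
  let ?e = "unit_seq i :: 'i \<Rightarrow> 'k"
  let ?V = "{y \<in> lp_space p. ?e \<in> lp_space p \<and> lp_dist p ?e y < \<epsilon>}"
  have "?e \<in> ?V" using \<epsilon> by (simp add: lp_space_unit_seq lp_dist_def lp_norm_def)
  then have "?V \<noteq> {}" by blast
  moreover obtain x where "x \<in> lp_space p"
    "\<And>V. openin (lp_topology p) V \<Longrightarrow> V \<noteq> {} \<Longrightarrow> upper_banach_density (return_times T x V) > 0"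
    using rhc unfolding reiteratively_hypercyclic_def topspace_lp_topology[OF p] by blast
  ultimately have "x \<in> lp_space p" "upper_banach_density (return_times T x ?V) > 0"
    using openin_lp_ball[OF p] by blast+
  then show ?thesis by (intro that) (simp_all add: return_times_def lp_space_unit_seq)
qed

text \<open>
  The solution of \<open>v k = w (k + 1) * v (k + 1)\<close> with value 1 at 0.
\<close>

definition conj_weight :: "(int \<Rightarrow> 'k::field) \<Rightarrow> int \<Rightarrow> 'k" where
  "conj_weight w k = (if 0 \<le> k then inverse (\<Prod>i=1..k. w i) else (\<Prod>i=k + 1..0. w i))"

lemma conj_weight_0: "conj_weight w 0 = 1"
  by (simp add: conj_weight_def)

lemma conj_weight_rec:
  assumes "\<And>k. w k \<noteq> 0"
  shows "conj_weight w k = w (k + 1) * conj_weight w (k + 1)"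
proof (cases "0 \<le> k")
  case True
  then have "{1..k + 1} = insert (k + 1) {1..k}" by auto
  then show ?thesis using True assms by (simp add: conj_weight_def)
next
  case False
  then have "{k + 1..0} = insert (k + 1) {k + 2..0}" by auto
  moreover have "conj_weight w (k + 1) = (\<Prod>i=k + 2..0. w i)"
    using False by (cases "k = -1") (auto simp: conj_weight_def add.assoc)
  ultimately show ?thesis using False by (simp add: conj_weight_def)
qed

lemma conj_weight_nonzero: "(\<And>k. w k \<noteq> 0) \<Longrightarrow> conj_weight w k \<noteq> 0"
  by (simp add: conj_weight_def)

lemma lp_restrict_nat:
  fixes Y :: "int \<Rightarrow> 'k::{real_normed_field,euclidean_space}"
  assumes p: "1 \<le> p" and Y: "Y \<in> lp_space p"
  shows "(\<lambda>k. Y (int k)) \<in> lp_space p" "lp_norm p (\<lambda>k. Y (int k)) \<le> lp_norm p Y"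
proof -
  let ?f = "\<lambda>k. norm (Y k) powr p"
  have f: "?f summable_on UNIV" using Y by (simp add: lp_space_def)
  then have fr: "?f summable_on range int" by (rule summable_on_subset_banach) simp
  then show "(\<lambda>k. Y (int k)) \<in> lp_space p"
    by (simp add: lp_space_def summable_on_reindex o_def)
  have "(\<Sum>\<^sub>\<infinity>k. ?f (int k)) = infsum ?f (range int)"
    by (simp add: infsum_reindex o_def)
  also have "\<dots> \<le> infsum ?f UNIV" by (rule infsum_mono_neutral[OF fr f]) auto
  finally show "lp_norm p (\<lambda>k. Y (int k)) \<le> lp_norm p Y"
    unfolding lp_norm_def using p by (intro powr_mono2 infsum_nonneg) auto
qed

definition zero_extend :: "(nat \<Rightarrow> 'k::zero) \<Rightarrow> int \<Rightarrow> 'k" where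
  "zero_extend x k = (if 0 \<le> k then x (nat k) else 0)"

lemma zero_extend_int [simp]: "zero_extend x (int k) = x k"
  by (simp add: zero_extend_def)

lemma lp_space_zero_extend:
  assumes "x \<in> lp_space p"
  shows "zero_extend x \<in> lp_space p"
proof -
  have "(\<lambda>k. norm (zero_extend x k) powr p) summable_on range int"
    using assms by (simp add: summable_on_reindex o_def lp_space_def)
  then show ?thesis
    unfolding lp_space_def mem_Collect_eq
    by (rule summable_on_cong_neutral[THEN iffD1, rotated -1])
      (auto simp: zero_extend_def intro: range_eqI[of _ int "nat _"])
qed

lemma funpow_weighted_shift_restrict:
  fixes w :: "nat \<Rightarrow> 'k::{real_normed_field,euclidean_space}"
  assumes "\<And>k. 1 \<le> k \<Longrightarrow> W (int k) = w k"
  shows "(weighted_shift w ^^ n) (\<lambda>k. X (int k)) = (\<lambda>k. (weighted_shift W ^^ n) X (int k))"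
proof (induction n arbitrary: X)
  case (Suc n)
  have "weighted_shift w (\<lambda>k. X (int k)) = (\<lambda>k. weighted_shift W X (int k))"
    using assms[of "_ + 1"] by (simp add: weighted_shift_def fun_eq_iff add.commute)
  with Suc.IH[of "weighted_shift W X"] show ?case
    by (simp add: funpow_Suc_right del: funpow.simps)
qed simp

text \<open>
  Restriction to the nonnegative coordinates is a continuous surjection that intertwines the two
  shifts, so it maps frequently hypercyclic vectors to frequently hypercyclic vectors.
\<close>

lemma frequently_hypercyclic_unilateral_of_bilateral:
  fixes w :: "nat \<Rightarrow> 'k::{real_normed_field,euclidean_space}"
  assumes p: "1 \<le> p" and W: "\<And>k. 1 \<le> k \<Longrightarrow> W (int k) = w k"
    and fhc: "frequently_hypercyclic (lp_topology p) (weighted_shift W)"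
  shows "frequently_hypercyclic (lp_topology p) (weighted_shift w)"
proof -
  obtain X where X: "X \<in> lp_space p" and freq: "\<And>U. openin (lp_topology p) U \<Longrightarrow> U \<noteq> {} \<Longrightarrow>
      lower_density (return_times (weighted_shift W) X U) > 0"
    using fhc unfolding frequently_hypercyclic_def topspace_lp_topology[OF p] by blast
  show ?thesis
    unfolding frequently_hypercyclic_def topspace_lp_topology[OF p]
  proof (intro bexI[of _ "\<lambda>k. X (int k)"] allI impI lp_restrict_nat(1)[OF p X])
    fix V :: "(nat \<Rightarrow> 'k) set" assume V: "openin (lp_topology p) V \<and> V \<noteq> {}"
    define U where "U = {Y \<in> lp_space p. (\<lambda>k. Y (int k)) \<in> V}"
    have "openin (lp_topology p) U"
      unfolding openin_lp_topology_iff[OF p]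
    proof (intro conjI ballI)
      show "U \<subseteq> lp_space p" by (auto simp: U_def)
      fix Y assume Y: "Y \<in> U"
      then obtain \<epsilon> where \<epsilon>: "\<epsilon> > 0"
        "\<forall>b\<in>lp_space p. lp_dist p (\<lambda>k. Y (int k)) b < \<epsilon> \<longrightarrow> b \<in> V"
        using V unfolding openin_lp_topology_iff[OF p] U_def by blast
      show "\<exists>\<epsilon>>0. \<forall>Z\<in>lp_space p. lp_dist p Y Z < \<epsilon> \<longrightarrow> Z \<in> U"
      proof (intro exI[of _ \<epsilon>] conjI ballI impI)
        fix Z assume Z: "Z \<in> lp_space p" "lp_dist p Y Z < \<epsilon>"
        have "lp_dist p (\<lambda>k. Y (int k)) (\<lambda>k. Z (int k)) \<le> lp_dist p Y Z"
          unfolding lp_dist_def using Y Z by (intro lp_restrict_nat(2) lp_space_diff p) (auto simp: U_def)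
        with \<epsilon>(2) Z lp_restrict_nat(1)[OF p Z(1)] show "Z \<in> U" by (auto simp: U_def)
      qed (rule \<epsilon>(1))
    qed
    moreover obtain a where a: "a \<in> V" "a \<in> lp_space p"
      using V unfolding openin_lp_topology_iff[OF p] by blast
    then have "zero_extend a \<in> U" by (simp add: U_def lp_space_zero_extend)
    ultimately have "lower_density (return_times (weighted_shift W) X U) > 0"
      by (intro freq) auto
    also have "lower_density (return_times (weighted_shift W) X U)
        \<le> lower_density (return_times (weighted_shift w) (\<lambda>k. X (int k)) V)"
      by (rule lower_density_mono)
        (auto simp: return_times_def U_def funpow_weighted_shift_restrict[of W w, OF W])
    finally show "lower_density (return_times (weighted_shift w) (\<lambda>k. X (int k)) V) > 0" .
  qed
qed

lemma frequently_hypercyclic_imp_reiteratively: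
  "frequently_hypercyclic X T \<Longrightarrow> reiteratively_hypercyclic X T"
  unfolding frequently_hypercyclic_def reiteratively_hypercyclic_def
  using lower_density_pos_imp_upper_banach_density_pos by blast

section \<open>Reiteratively hypercyclic shifts are frequently hypercyclic\<close>

lemma bilateral_reiteratively_imp_frequently:
  fixes w :: "int \<Rightarrow> 'k::{real_normed_field,euclidean_space}"
  assumes p: "1 \<le> p" and M: "\<And>k. norm (w k) \<le> M" and w0: "\<And>k. w k \<noteq> 0"
    and rhc: "reiteratively_hypercyclic (lp_topology p) (weighted_shift w)"
  shows "frequently_hypercyclic (lp_topology p) (weighted_shift w)"
proof -
  define v where "v = conj_weight w"
  have vw: "v k = w (k + 1) * v (k + 1)" and v0: "v k \<noteq> 0" for k
    unfolding v_def using w0 by (rule conj_weight_rec, rule conj_weight_nonzero)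
  let ?T = "weighted_shift w" and ?e = "unit_seq 0 :: int \<Rightarrow> 'k"
  obtain x where "upper_banach_density
      {n. (?T ^^ n) x \<in> lp_space p \<and> lp_dist p ?e ((?T ^^ n) x) < 1 / 2} > 0"
    using reiteratively_hypercyclic_return_to_unit[OF p _ rhc, of "1 / 2" 0] by force
  define z where "z k = x k / v k" for k
  have x: "x = (\<lambda>k. v k * z k)" using v0 by (simp add: z_def fun_eq_iff)
  have orbit: "(?T ^^ n) x = (\<lambda>k. v k * z (k + int n))" for n
    unfolding x by (rule funpow_weighted_shift_conj) (rule vw)
  have "v \<in> lp_space p"
  proof (rule weights_in_lp_of_return_set[where w = w and M = M and I = UNIV and z = z])
    show "1 \<le> p" "0 \<in> (UNIV :: int set)" using p by auto
    show "v k = w (k + 1) * v (k + 1)" "norm (w k) \<le> M" for k by (rule vw, rule M)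
    show "v 0 = 1" by (simp add: v_def conj_weight_0)
    show "upper_banach_density
      {n. (?T ^^ n) x \<in> lp_space p \<and> lp_dist p ?e ((?T ^^ n) x) < 1 / 2} > 0" by fact
    show "(\<lambda>k. norm (v k) powr p) summable_on - UNIV" by simp
    fix n and G :: "int set"
    assume "n \<in> {n. (?T ^^ n) x \<in> lp_space p \<and> lp_dist p ?e ((?T ^^ n) x) < 1 / 2}" and G: "finite G"
    then have "(?T ^^ n) x \<in> lp_space p" "lp_norm p (\<lambda>k. ?e k - (?T ^^ n) x k) < 1 / 2"
      by (auto simp: lp_dist_def)
    from sum_powr_le_of_lp_norm_less[OF p lp_space_diff[OF p lp_space_unit_seq this(1)] this(2) G]
    show "(\<Sum>k\<in>G. norm (?e k - v k * z (k + int n)) powr p) \<le> (1 / 2) powr p"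
      by (simp add: orbit)
  qed
  with p vw v0 show ?thesis by (rule frequently_hypercyclic_bilateral)
qed

text \<open>
  Going left from 0, the solution is the geometric sequence \<open>(1 / 2) ^ j\<close>.
\<close>

lemma conj_weight_summable_on_neg:
  fixes W :: "int \<Rightarrow> 'k::{real_normed_field,euclidean_space}"
  assumes p: "1 \<le> p" and W: "\<And>k. k \<le> 0 \<Longrightarrow> W k = inverse 2"
  shows "(\<lambda>k. norm (conj_weight W k) powr p) summable_on - {0..}"
proof -
  have neg: "- {0::int..} = range (\<lambda>j. - int (Suc j))"
  proof (intro set_eqI iffI)
    fix k :: int assume "k \<in> - {0..}"
    then have "k = - int (Suc (nat (- k - 1)))" by simp
    then show "k \<in> range (\<lambda>j. - int (Suc j))" by blast
  qed auto
  have nrm: "norm (conj_weight W (- int (Suc j))) = (1 / 2) ^ Suc j" for j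
  proof -
    have "conj_weight W (- int (Suc j)) = (\<Prod>i=- int j..0. W i)"
      by (simp add: conj_weight_def)
    also have "\<dots> = (\<Prod>i=- int j..0. inverse 2)"
      by (rule prod.cong) (simp_all add: W)
    also have "\<dots> = inverse 2 ^ Suc j" by (simp add: nat_add_distrib)
    finally show ?thesis by (simp only: norm_power norm_inverse norm_numeral) (simp add: inverse_eq_divide)
  qed
  have le: "((1 / 2 :: real) ^ Suc j) powr p \<le> (1 / 2) ^ Suc j" for j
  proof -
    have "((1 / 2 :: real) ^ Suc j) powr p \<le> ((1 / 2) ^ Suc j) powr 1"
      by (rule powr_mono'[OF p zero_le_power power_le_one]) simp_all
    also have "\<dots> = (1 / 2) ^ Suc j" by (rule powr_one) (rule zero_le_power, simp)
    finally show ?thesis .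
  qed
  have sm: "(\<lambda>j. (1 / 2 :: real) ^ Suc j) summable_on UNIV"
  proof (rule norm_summable_imp_summable_on)
    have "summable (\<lambda>j. (1 / 2 :: real) ^ Suc j)"
      by (rule summable_Suc_iff[THEN iffD2]) (simp add: summable_geometric)
    moreover have "norm ((1 / 2 :: real) ^ Suc j) = (1/2) ^ Suc j" for j by (simp only: norm_power) simp
    ultimately show "summable (\<lambda>j. norm ((1 / 2 :: real) ^ Suc j))" by presburger
  qed
  have "(\<lambda>j. norm (conj_weight W (- int (Suc j))) powr p) summable_on UNIV"
    by (rule summable_on_comparison_test[OF sm]) (simp_all only: nrm le powr_ge_zero)
  moreover have "inj (\<lambda>j. - int (Suc j))" by (simp add: inj_on_def)
  ultimately show ?thesis unfolding neg by (simp add: summable_on_reindex o_def)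
qed

text \<open>
  The weights are extended to the integers by \<open>1 / 2\<close>.  The return times of the unilateral
  shift control the nonnegative half of \<open>v\<close>, the extension is harmless on the other half, and the
  resulting bilateral shift is frequently hypercyclic.
\<close>

lemma unilateral_reiteratively_imp_frequently:
  fixes w :: "nat \<Rightarrow> 'k::{real_normed_field,euclidean_space}"
  assumes p: "1 \<le> p" and M: "\<And>k. 1 \<le> k \<Longrightarrow> norm (w k) \<le> M"
    and w0: "\<And>k. 1 \<le> k \<Longrightarrow> w k \<noteq> 0"
    and rhc: "reiteratively_hypercyclic (lp_topology p) (weighted_shift w)"
  shows "frequently_hypercyclic (lp_topology p) (weighted_shift w)"
proof -
  define W where "W k = (if 1 \<le> k then w (nat k) else inverse 2)" for k :: int
  have W: "W (int k) = w k" if "1 \<le> k" for k using that by (simp add: W_def)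
  have W0: "W k \<noteq> 0" for k using w0 by (simp add: W_def)
  have WM: "norm (W k) \<le> max 1 M" for k
  proof (cases "1 \<le> k")
    case True
    then show ?thesis using M[of "nat k"] by (simp add: W_def max.coboundedI2)
  qed (simp add: W_def norm_inverse max.coboundedI1)
  define v where "v = conj_weight W"
  have vW: "v k = W (k + 1) * v (k + 1)" and v0: "v k \<noteq> 0" for k
    unfolding v_def using W0 by (rule conj_weight_rec, rule conj_weight_nonzero)
  let ?T = "weighted_shift w" and ?e = "unit_seq 0 :: nat \<Rightarrow> 'k"
  obtain x where "upper_banach_density
      {n. (?T ^^ n) x \<in> lp_space p \<and> lp_dist p ?e ((?T ^^ n) x) < 1 / 2} > 0"
    using reiteratively_hypercyclic_return_to_unit[OF p _ rhc, of "1 / 2" 0] by force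
  define z where "z k = zero_extend x k / v k" for k
  have x: "zero_extend x = (\<lambda>k. v k * z k)" using v0 by (simp add: z_def fun_eq_iff)
  have orbit: "(?T ^^ n) x = (\<lambda>k. v (int k) * z (int k + int n))" for n
  proof -
    have "(?T ^^ n) (\<lambda>k. zero_extend x (int k))
        = (\<lambda>k. (weighted_shift W ^^ n) (zero_extend x) (int k))"
      by (rule funpow_weighted_shift_restrict) (rule W)
    moreover have "(weighted_shift W ^^ n) (zero_extend x) = (\<lambda>k. v k * z (k + int n))"
      unfolding x by (rule funpow_weighted_shift_conj) (rule vW)
    ultimately show ?thesis by simp
  qed
  have "v \<in> lp_space p"
  proof (rule weights_in_lp_of_return_set[where w = W and M = "max 1 M" and I = "{0..}" and z = z])
    show "1 \<le> p" by (rule p)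
    show "v k = W (k + 1) * v (k + 1)" "norm (W k) \<le> max 1 M" for k by (rule vW, rule WM)
    show "v 0 = 1" by (simp add: v_def conj_weight_0)
    show "(0::int) \<in> {0..}" by simp
    show "upper_banach_density
      {n. (?T ^^ n) x \<in> lp_space p \<and> lp_dist p ?e ((?T ^^ n) x) < 1 / 2} > 0" by fact
    show "(\<lambda>k. norm (v k) powr p) summable_on - {0..}"
      unfolding v_def using p by (rule conj_weight_summable_on_neg) (simp add: W_def)
    fix n and G :: "int set"
    assume "n \<in> {n. (?T ^^ n) x \<in> lp_space p \<and> lp_dist p ?e ((?T ^^ n) x) < 1 / 2}"
      and G: "finite G" "G \<subseteq> {0..}"
    then have near: "(?T ^^ n) x \<in> lp_space p" "lp_norm p (\<lambda>k. ?e k - (?T ^^ n) x k) < 1 / 2"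
      by (auto simp: lp_dist_def)
    have "G = int ` (nat ` G)" using G(2) by (force simp: image_image)
    then have "(\<Sum>k\<in>G. norm (unit_seq 0 k - v k * z (k + int n)) powr p)
        = (\<Sum>k\<in>nat ` G. norm (unit_seq 0 (int k) - v (int k) * z (int k + int n)) powr p)"
      by (metis (no_types, lifting) inj_of_nat inj_on_subset subset_UNIV sum.reindex_cong)
    also have "\<dots> = (\<Sum>k\<in>nat ` G. norm (?e k - (?T ^^ n) x k) powr p)"
      by (simp add: orbit unit_seq_def)
    also have "\<dots> \<le> (1 / 2) powr p"
      by (rule sum_powr_le_of_lp_norm_less[OF p lp_space_diff[OF p lp_space_unit_seq near(1)] near(2)])
        (use G in simp)
    finally show "(\<Sum>k\<in>G. norm (unit_seq 0 k - v k * z (k + int n)) powr p) \<le> (1 / 2) powr p" .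
  qed
  with p vW v0 have "frequently_hypercyclic (lp_topology p) (weighted_shift W)"
    by (rule frequently_hypercyclic_bilateral)
  with p W show ?thesis by (rule frequently_hypercyclic_unilateral_of_bilateral)
qed

theorem theorem23:
  fixes p :: real
  assumes "1 \<le> p"
  shows "(\<forall>w :: int \<Rightarrow> 'k::{real_normed_field,euclidean_space}.
            bounded (range w) \<and> (\<forall>n. w n \<noteq> 0) \<longrightarrow>
            (reiteratively_hypercyclic (lp_topology p) (weighted_shift w) \<longleftrightarrow>
             frequently_hypercyclic (lp_topology p) (weighted_shift w)))
       \<and> (\<forall>w :: nat \<Rightarrow> 'k.
            bounded (w ` {1..}) \<and> (\<forall>n\<ge>1. w n \<noteq> 0) \<longrightarrow>
            (reiteratively_hypercyclic (lp_topology p) (weighted_shift w) \<longleftrightarrow>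
             frequently_hypercyclic (lp_topology p) (weighted_shift w)))"
proof (intro conjI allI impI iffI)
  fix w :: "int \<Rightarrow> 'k"
  assume w: "bounded (range w) \<and> (\<forall>n. w n \<noteq> 0)"
    and rhc: "reiteratively_hypercyclic (lp_topology p) (weighted_shift w)"
  then obtain M where "\<And>k. norm (w k) \<le> M" unfolding bounded_iff by blast
  then show "frequently_hypercyclic (lp_topology p) (weighted_shift w)"
    using bilateral_reiteratively_imp_frequently[OF assms _ _ rhc] w by blast
next
  fix w :: "nat \<Rightarrow> 'k"
  assume w: "bounded (w ` {1..}) \<and> (\<forall>n\<ge>1. w n \<noteq> 0)"
    and rhc: "reiteratively_hypercyclic (lp_topology p) (weighted_shift w)"
  then obtain M where "\<And>k. 1 \<le> k \<Longrightarrow> norm (w k) \<le> M" unfolding bounded_iff by auto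
  then show "frequently_hypercyclic (lp_topology p) (weighted_shift w)"
    using unilateral_reiteratively_imp_frequently[OF assms _ _ rhc] w by blast
qed (erule frequently_hypercyclic_imp_reiteratively)+

end
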